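(* Let $d\ge 1$, $D=(\mathbb{R}/\mathbb{Z})^d$ and $T>0$. Let $(B,v)$ be a dissipative solution (as defined in the context) of the magnetic relaxation equations $$\partial_t B+\nabla\cdot(B\otimes v-v\otimes B)=0,\qquad v=\mathbb{P}\,\nabla\cdot(B\otimes B),\qquad \nabla\cdot B=0 \qquad (\mathrm{MRE})$$ on $[0,T]\times D$, and let $(\beta,\omega)$ be a smooth solution of the same equations on $[0,T]\times D$, i.e. $\beta,\omega:[0,T]\times D\to\mathbb{R}^d$ are smooth and satisfy $\partial_t\beta+(\omega\cdot\nabla)\beta-(\beta\cdot\nabla)\omega=0$, $\omega=\mathbb{P}\,\nabla\cdot(\beta\otimes\beta)$, $\nabla\cdot\beta=\nabla\cdot\omega=0$. Then there is a constant $C$, depending only on the spatial Lipschitz constant of $(\beta,\omega)$ on $[0,T]\times D$, such that for all $t\in[0,T]$ $$\|(B-\beta)(t,\cdot)\|^2+\int_0^t \exp(C(t-s))\,\frac12\,\|v(s,\cdot)-\omega(s,\cdot)\|^2\,ds\ \le\ \|(B-\beta)(0,\cdot)\|^2\exp(Ct).$$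
   Context: Notation. $D=(\mathbb{R}/\mathbb{Z})^d$ is the flat torus, $\|\cdot\|$ is the $L^2$ norm on $D$. $L^2_{\mathrm{div},0}(D;\mathbb{R}^d)$ is the space of all $L^2$ vector fields on $D$ that are divergence-free (in the sense of distributions), and $\mathbb{P}$ is the $L^2$-orthogonal (Helmholtz–Leray) projector onto it. The divergence of a matrix field acts on the second index: $(\nabla\cdot(B\otimes v-v\otimes B))_i=\sum_j\partial_j(B_iv_j-v_iB_j)$. For a real $r\ge 0$ and $B\in L^2_{\mathrm{div},0}(D;\mathbb{R}^d)$ define $$K_r(B)=\sup\Big\{\int_D (B\otimes B):(\nabla z+\nabla z^T+rI)\,dx-\|z\|^2\ :\ z\in C^1(D;\mathbb{R}^d),\ \nabla\cdot z=0,\ \nabla z+\nabla z^T+rI\ge 0\Big\}\in[0,+\infty],$$ where $I$ is the identity matrix, the inequality is pointwise in the sense of symmetric matrices, and $(B\otimes B):M=\sum_{i,j}B_iB_jM_{ij}$. Dissipative solution. Given $T>0$ and $B^0\in L^2_{\mathrm{div},0}(D;\mathbb{R}^d)$, a pair $(B,v):[0,T]\times D\to\mathbb{R}^d\times\mathbb{R}^d$ is a dissipative solution of (MRE) with initial condition $B^0$ (up to time $T$) if: (i) $B$ is weakly continuous from $[0,T]$ to $L^2_{\mathrm{div},0}(D;\mathbb{R}^d)$ and $B(0)=B^0$; (ii) $v$ is square-integrable from $[0,T]$ to $L^2_{\mathrm{div},0}(D;\mathbb{R}^d)$; (iii) $\partial_tB+\nabla\cdot(B\otimes v-v\otimes B)=0$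 in the sense of distributions; (iv) for every nonnegative integrable function $r:[0,T]\to[0,\infty)$, with $R(t)=\int_0^tr(s)\,ds$, and all $t\in[0,T]$, $$\|B(t,\cdot)\|^2+\int_0^t\big[\|v(s,\cdot)\|^2+K_{r(s)}(B(s,\cdot))\big]\exp(R(t)-R(s))\,ds\le\|B(0,\cdot)\|^2\exp(R(t)).$$ *)

theory Defs
  imports "HOL-Analysis.Analysis"
begin

section \<open>Functions on the flat torus\<close>

text \<open>
  Functions on the torus are functions on \<^typ>\<open>real^'n\<close> that are periodic with respect to the
  integer lattice, and integrals are taken over the unit cube. Elements of the Lebesgue spaces
  are represented by Borel functions.
\<close>

definition periodic :: "((real, 'n::finite) vec \<Rightarrow> 'b) \<Rightarrow> bool" where
  "periodic f \<longleftrightarrow> (\<forall>x k. (\<forall>i. k $ i \<in> \<int>) \<longrightarrow> f (x + k) = f x)"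

definition torus :: "(real, 'n::finite) vec measure" where
  "torus = restrict_space lborel (cbox 0 1)"

text \<open>
  Continuous differentiability of order \<open>k\<close>. Derivatives are taken within \<open>S\<close>, so that for
  \<open>S = {0..T} \<times> UNIV\<close> all of them extend continuously up to the initial and the final time. They
  are unique for the sets used here, namely \<open>UNIV\<close> and \<open>{0..T} \<times> UNIV\<close> with \<open>T > 0\<close>.
\<close>

primrec Ck_on :: "nat \<Rightarrow> 'a::euclidean_space set \<Rightarrow> ('a \<Rightarrow> 'b::euclidean_space) \<Rightarrow> bool" where
  "Ck_on 0 S f \<longleftrightarrow> continuous_on S f"
| "Ck_on (Suc k) S f \<longleftrightarrow>
    (\<exists>f'. (\<forall>x\<in>S. (f has_derivative f' x) (at x within S)) \<and> (\<forall>h. Ck_on k S (\<lambda>x. f' x h)))"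

definition smooth_on :: "'a::euclidean_space set \<Rightarrow> ('a \<Rightarrow> 'b::euclidean_space) \<Rightarrow> bool" where
  "smooth_on S f \<longleftrightarrow> (\<forall>k. Ck_on k S f)"

text \<open>
  Convention: \<^term>\<open>jacobian f (at x) $ i $ j\<close> is the \<open>j\<close>-th partial derivative of the \<open>i\<close>-th
  component, so that the term \<open>(u \<bullet> \<nabla>) f\<close> is \<^term>\<open>jacobian f (at x) *v u x\<close>. The inner product
  of the type \<^typ>\<open>real^'n^'m\<close> is the contraction \<open>A : M\<close>.
\<close>

definition grad :: "((real, 'n::finite) vec \<Rightarrow> real) \<Rightarrow> real^'n \<Rightarrow> real^'n" where
  "grad f x = (\<chi> i. frechet_derivative f (at x) (axis i 1))"

definition divergence :: "(real^'n \<Rightarrow> real^'n) \<Rightarrow> (real, 'n::finite) vec \<Rightarrow> real" where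
  "divergence f x = trace (jacobian f (at x))"

definition matrix_divergence :: "(real^'n \<Rightarrow> real^'n^'n) \<Rightarrow> (real, 'n::finite) vec \<Rightarrow> real^'n" where
  "matrix_divergence A x = (\<chi> i. divergence (\<lambda>y. A y $ i) x)"

definition outer :: "real^'n \<Rightarrow> real^'m \<Rightarrow> ((real, 'm::finite) vec, 'n::finite) vec" where
  "outer u v = (\<chi> i j. u $ i * v $ j)"

definition nonneg_matrix :: "((real, 'n::finite) vec, 'n) vec \<Rightarrow> bool" where
  "nonneg_matrix A \<longleftrightarrow> (\<forall>y. 0 \<le> y \<bullet> (A *v y))"


section \<open>Square-integrable and divergence-free fields\<close>

definition L2 :: "(real^'n \<Rightarrow> (real, 'n::finite) vec) set" where
  "L2 = {f. periodic f \<and> f \<in> borel_measurable borel \<and> integrable torus (\<lambda>x. (norm (f x))\<^sup>2)}"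

definition L2_inner ::
  "(real^'n \<Rightarrow> real^'n) \<Rightarrow> (real^'n \<Rightarrow> (real, 'n::finite) vec) \<Rightarrow> real" where
  "L2_inner f g = (LINT x|torus. f x \<bullet> g x)"

definition L2_norm :: "(real^'n \<Rightarrow> (real, 'n::finite) vec) \<Rightarrow> real" where
  "L2_norm f = sqrt (LINT x|torus. (norm (f x))\<^sup>2)"

definition L2_div :: "(real^'n \<Rightarrow> (real, 'n::finite) vec) set" where
  "L2_div = {f \<in> L2. \<forall>\<phi>. periodic \<phi> \<and> smooth_on UNIV \<phi> \<longrightarrow> L2_inner f (grad \<phi>) = 0}"

text \<open>
  \<open>u\<close> is the orthogonal projection of \<open>f\<close> onto \<^const>\<open>L2_div\<close>. This is a relation because the
  projection is determined only almost everywhere.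
\<close>

definition helmholtz_projection ::
  "(real^'n \<Rightarrow> real^'n) \<Rightarrow> (real^'n \<Rightarrow> (real, 'n::finite) vec) \<Rightarrow> bool" where
  "helmholtz_projection f u \<longleftrightarrow>
     f \<in> L2 \<and> u \<in> L2_div \<and> (\<forall>w\<in>L2_div. L2_inner (\<lambda>x. f x - u x) w = 0)"


section \<open>The functional \<open>K\<close>\<close>

definition strain :: "real \<Rightarrow> (real^'n \<Rightarrow> real^'n) \<Rightarrow> real^'n \<Rightarrow> ((real, 'n::finite) vec, 'n) vec" where
  "strain r z x = jacobian z (at x) + transpose (jacobian z (at x)) + r *\<^sub>R mat 1"

definition K_admissible :: "real \<Rightarrow> (real^'n \<Rightarrow> (real, 'n::finite) vec) set" where
  "K_admissible r = {z. periodic z \<and> Ck_on 1 UNIV z \<and> (\<forall>x. divergence z x = 0) \<and>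
                        (\<forall>x. nonneg_matrix (strain r z x))}"

definition K_functional :: "real \<Rightarrow> (real^'n \<Rightarrow> (real, 'n::finite) vec) \<Rightarrow> ereal" where
  "K_functional r B = (SUP z \<in> K_admissible r.
     ereal ((LINT x|torus. outer (B x) (B x) \<bullet> strain r z x) - (L2_norm z)\<^sup>2))"


section \<open>Dissipative solutions\<close>

text \<open>
  Square-integrable maps from \<open>{0..T}\<close> to the Lebesgue space and weakly continuous ones have
  jointly Borel measurable representatives. In the weakly continuous case the representative can be
  chosen for every \<open>t\<close>, as the limit of the averages of \<open>B t\<close> over shrinking balls. The
  measurability requirement below therefore only selects representatives.
\<close>

definition spacetime_measurable :: "real \<Rightarrow> (real \<Rightarrow> real^'n \<Rightarrow> (real, 'n::finite) vec) \<Rightarrow> bool" where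
  "spacetime_measurable T u \<longleftrightarrow> set_borel_measurable borel ({0..T} \<times> UNIV) (\<lambda>(t, x). u t x)"

definition weakly_continuous_L2_div ::
  "real \<Rightarrow> (real \<Rightarrow> real^'n \<Rightarrow> (real, 'n::finite) vec) \<Rightarrow> bool" where
  "weakly_continuous_L2_div T B \<longleftrightarrow> spacetime_measurable T B \<and> (\<forall>t\<in>{0..T}. B t \<in> L2_div) \<and>
     (\<forall>w\<in>L2_div. continuous_on {0..T} (\<lambda>t. L2_inner (B t) w))"

definition square_integrable_L2_div ::
  "real \<Rightarrow> (real \<Rightarrow> real^'n \<Rightarrow> (real, 'n::finite) vec) \<Rightarrow> bool" where
  "square_integrable_L2_div T v \<longleftrightarrow> spacetime_measurable T v \<and>
     (AE t in lborel. t \<in> {0..T} \<longrightarrow> v t \<in> L2_div) \<and>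
     set_integrable lborel {0..T} (\<lambda>t. (L2_norm (v t))\<^sup>2)"

text \<open>Smooth test fields whose support is a compact subset of \<open>{0<..<T} \<times> UNIV\<close> on the torus.\<close>

definition test_field :: "real \<Rightarrow> (real \<Rightarrow> real^'n \<Rightarrow> (real, 'n::finite) vec) \<Rightarrow> bool" where
  "test_field T \<phi> \<longleftrightarrow> smooth_on UNIV (\<lambda>(t, x). \<phi> t x) \<and> (\<forall>t. periodic (\<phi> t)) \<and>
     (\<exists>a b. 0 < a \<and> b < T \<and> (\<forall>t x. t \<notin> {a..b} \<longrightarrow> \<phi> t x = 0))"

text \<open>
  The equation \<open>\<partial>\<^sub>t B + \<nabla> \<bullet> (B \<otimes> v - v \<otimes> B) = 0\<close> in the sense of distributions, the divergence
  acting on the second index.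
\<close>

definition weak_induction ::
  "real \<Rightarrow> (real \<Rightarrow> real^'n \<Rightarrow> real^'n) \<Rightarrow> (real \<Rightarrow> real^'n \<Rightarrow> (real, 'n::finite) vec) \<Rightarrow> bool" where
  "weak_induction T B v \<longleftrightarrow> (\<forall>\<phi>. test_field T \<phi> \<longrightarrow>
     (LINT t:{0..T}|lborel. LINT x|torus.
        B t x \<bullet> vector_derivative (\<lambda>s. \<phi> s x) (at t) +
        (outer (B t x) (v t x) - outer (v t x) (B t x)) \<bullet> jacobian (\<phi> t) (at x)) = 0)"

text \<open>
  The integrand in the next definition takes values in \<open>[0, \<infinity>]\<close>. The value of \<^const>\<open>K_functional\<close> is
  nonnegative since the zero field is admissible for \<open>r \<ge> 0\<close>, so \<^const>\<open>e2ennreal\<close> is an embedding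
  here.
\<close>

definition dissipation_inequality ::
  "real \<Rightarrow> (real \<Rightarrow> real^'n \<Rightarrow> real^'n) \<Rightarrow> (real \<Rightarrow> real^'n \<Rightarrow> (real, 'n::finite) vec) \<Rightarrow> bool" where
  "dissipation_inequality T B v \<longleftrightarrow>
     (\<forall>r R. (\<forall>s\<in>{0..T}. 0 \<le> r s) \<and> set_integrable lborel {0..T} r \<and>
            (\<forall>t. R t = (LINT s:{0..t}|lborel. r s)) \<longrightarrow>
       (\<forall>t\<in>{0..T}.
          ennreal ((L2_norm (B t))\<^sup>2) +
          (\<integral>\<^sup>+ s\<in>{0..t}. (ennreal ((L2_norm (v s))\<^sup>2) + e2ennreal (K_functional (r s) (B s))) *
                        ennreal (exp (R t - R s)) \<partial>lborel)
          \<le> ennreal ((L2_norm (B 0))\<^sup>2 * exp (R t))))"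

definition dissipative_solution ::
  "real \<Rightarrow> (real^'n \<Rightarrow> real^'n) \<Rightarrow>
   (real \<Rightarrow> real^'n \<Rightarrow> real^'n) \<Rightarrow> (real \<Rightarrow> real^'n \<Rightarrow> (real, 'n::finite) vec) \<Rightarrow> bool" where
  "dissipative_solution T B0 B v \<longleftrightarrow>
     B0 \<in> L2_div \<and>
     weakly_continuous_L2_div T B \<and> (AE x in torus. B 0 x = B0 x) \<and>
     square_integrable_L2_div T v \<and>
     weak_induction T B v \<and>
     dissipation_inequality T B v"


section \<open>Smooth solutions\<close>

definition smooth_solution ::
  "real \<Rightarrow> (real \<Rightarrow> real^'n \<Rightarrow> real^'n) \<Rightarrow> (real \<Rightarrow> real^'n \<Rightarrow> (real, 'n::finite) vec) \<Rightarrow> bool" where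
  "smooth_solution T \<beta> \<omega> \<longleftrightarrow>
     smooth_on ({0..T} \<times> UNIV) (\<lambda>(t, x). \<beta> t x) \<and>
     smooth_on ({0..T} \<times> UNIV) (\<lambda>(t, x). \<omega> t x) \<and>
     (\<forall>t\<in>{0..T}.
        periodic (\<beta> t) \<and> periodic (\<omega> t) \<and>
        (\<forall>x. vector_derivative (\<lambda>s. \<beta> s x) (at t within {0..T}) +
             jacobian (\<beta> t) (at x) *v \<omega> t x - jacobian (\<omega> t) (at x) *v \<beta> t x = 0) \<and>
        helmholtz_projection (matrix_divergence (\<lambda>x. outer (\<beta> t x) (\<beta> t x))) (\<omega> t) \<and>
        (\<forall>x. divergence (\<beta> t) x = 0 \<and> divergence (\<omega> t) x = 0))"

text \<open>The least Lipschitz constant in space that is valid for all times in \<open>{0..T}\<close>.\<close>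

definition spatial_lipschitz_constant ::
  "real \<Rightarrow> (real \<Rightarrow> real^'n \<Rightarrow> real^'n) \<Rightarrow> (real \<Rightarrow> real^'n \<Rightarrow> (real, 'n::finite) vec) \<Rightarrow> real" where
  "spatial_lipschitz_constant T \<beta> \<omega> =
     Inf {L. \<forall>t\<in>{0..T}. L-lipschitz_on UNIV (\<lambda>x. (\<beta> t x, \<omega> t x))}"

end

theory Submission
  imports Defs
begin

text \<open>
  This is a relative energy argument. If \<open>L\<close> is the Lipschitz constant and \<open>r = 2 L + 8 L\<^sup>2\<close>, then
  \<open>z = - \<omega>\<close> is admissible in \<open>K_r\<close>, so that the dissipation inequality with the constant weight \<open>r\<close>
  controls \<open>\<parallel>B\<parallel>\<^sup>2\<close>. Testing the weak equation with \<open>\<beta>\<close> gives the derivative of \<open>(B, \<beta>)\<close>, and that of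
  \<open>\<parallel>\<beta>\<parallel>\<^sup>2\<close> is classical. All terms combined, divergence-freeness and the equation for \<open>\<omega>\<close> leave, with
  \<open>w = v - \<omega>\<close> and \<open>b = B - \<beta>\<close>, the integral of
  \<open>\<bar>w\<bar>\<^sup>2 + r \<bar>b\<bar>\<^sup>2 - 2 b \<bullet> (b \<bullet> \<nabla>) \<omega> - 2 w \<bullet> (b \<bullet> \<nabla>) \<beta> + 2 b \<bullet> (w \<bullet> \<nabla>) \<beta>\<close>,
  which is at least that of \<open>\<bar>w\<bar>\<^sup>2 / 2\<close> by the choice of \<open>r\<close>. Since the weight \<open>exp (r (t - s))\<close> is already
  present in the dissipation inequality, no Gronwall lemma is needed.
\<close>

text \<open>The obstacle is regularity. \<open>B\<close> is only weakly continuous in time,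
  \<open>v\<close> only square-integrable, and the weak equation may be tested only with fields
  supported strictly inside \<open>(0, T)\<close>, while \<open>\<beta>\<close> is smooth only on
  the closed slab. So the product \<open>(B, \<beta>)\<close> is handled through a weak derivative
  on the open interval; cutoffs and continuity carry the resulting identity up to both endpoints.
  Testing with \<open>\<beta>\<close> produces no term quadratic in \<open>B\<close> alone. The
  choice \<open>z = - \<omega>\<close> supplies the one that is missing,
  \<open>- 2 B \<bullet> (B \<bullet> \<nabla>) \<omega>\<close>, and so lets all terms be
  recombined in \<open>b\<close> and \<open>w\<close>. The share \<open>2 L\<close> of
  \<open>r\<close> makes \<open>z\<close> admissible and later absorbs the \<open>\<omega>\<close>
  term in \<open>b\<close>; the share \<open>8 L\<^sup>2\<close> pays for the cross terms between
  \<open>b\<close> and \<open>w\<close>. All of \<open>\<parallel>B\<parallel>\<^sup>2\<close>,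
  \<open>(B, \<beta>)\<close> and \<open>\<parallel>\<beta>\<parallel>\<^sup>2\<close> are given the
  weight \<open>exp (- r s)\<close>, which is why their \<open>r\<close> terms add up to
  \<open>r \<bar>b\<bar>\<^sup>2\<close>.\<close>

section \<open>Functions of class \<open>C\<^sup>k\<close>\<close>

lemma Ck_on_continuous: "Ck_on k S f \<Longrightarrow> continuous_on S f"
  by (cases k) (auto simp: continuous_on_eq_continuous_within intro: has_derivative_continuous)

lemma Ck_on_Suc_imp: "Ck_on (Suc k) S f \<Longrightarrow> Ck_on k S f"
proof (induction k arbitrary: f)
  case 0
  then show ?case using Ck_on_continuous[of "Suc 0" S f] by simp
next
  case (Suc k)
  from Suc.prems obtain f' where
    "\<forall>x\<in>S. (f has_derivative f' x) (at x within S)" "\<forall>h. Ck_on (Suc k) S (\<lambda>x. f' x h)"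
    by auto
  with Suc.IH show ?case by auto
qed

lemma Ck_on_add: "Ck_on k S f \<Longrightarrow> Ck_on k S g \<Longrightarrow> Ck_on k S (\<lambda>x. f x + g x)"
proof (induction k arbitrary: f g)
  case 0
  then show ?case by (auto intro: continuous_intros)
next
  case (Suc k)
  from Suc.prems obtain f' g' where
    "\<forall>x\<in>S. (f has_derivative f' x) (at x within S)" "\<forall>h. Ck_on k S (\<lambda>x. f' x h)"
    "\<forall>x\<in>S. (g has_derivative g' x) (at x within S)" "\<forall>h. Ck_on k S (\<lambda>x. g' x h)"
    by auto
  with Suc.IH show ?case
    by (auto intro!: exI[of _ "\<lambda>x h. f' x h + g' x h"] has_derivative_add)
qed

lemma Ck_on_bounded_bilinear:
  assumes "bounded_bilinear pr" "Ck_on k S f" "Ck_on k S g"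
  shows "Ck_on k S (\<lambda>x. pr (f x) (g x))"
  using assms(2,3)
proof (induction k arbitrary: f g)
  case 0
  then show ?case by (auto intro: bounded_bilinear.continuous_on[OF assms(1)])
next
  case (Suc k)
  from Suc.prems obtain f' g' where *:
    "\<forall>x\<in>S. (f has_derivative f' x) (at x within S)" "\<forall>h. Ck_on k S (\<lambda>x. f' x h)"
    "\<forall>x\<in>S. (g has_derivative g' x) (at x within S)" "\<forall>h. Ck_on k S (\<lambda>x. g' x h)"
    by auto
  have "Ck_on k S f" "Ck_on k S g"
    using Suc.prems by (blast intro: Ck_on_Suc_imp)+
  then have "Ck_on k S (\<lambda>x. pr (f x) (g' x h) + pr (f' x h) (g x))" for h
    using * by (intro Ck_on_add Suc.IH) auto
  moreover have "((\<lambda>x. pr (f x) (g x)) has_derivative (\<lambda>h. pr (f x) (g' x h) + pr (f' x h) (g x)))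
      (at x within S)" if "x \<in> S" for x
    using * that by (intro bounded_bilinear.FDERIV[OF assms(1)]) auto
  ultimately show ?case
    unfolding Ck_on.simps by (intro exI[of _ "\<lambda>x h. pr (f x) (g' x h) + pr (f' x h) (g x)"]) blast
qed

lemma Ck_on_bounded_linear:
  assumes "bounded_linear L" "Ck_on k S f"
  shows "Ck_on k S (\<lambda>x. L (f x))"
  using assms(2)
proof (induction k arbitrary: f)
  case 0
  then show ?case by (auto intro: bounded_linear.continuous_on[OF assms(1)])
next
  case (Suc k)
  from Suc.prems obtain f' where *:
    "\<forall>x\<in>S. (f has_derivative f' x) (at x within S)" "\<forall>h. Ck_on k S (\<lambda>x. f' x h)"
    by auto
  with Suc.IH show ?case
    by (auto intro!: exI[of _ "\<lambda>x h. L (f' x h)"] bounded_linear.has_derivative[OF assms(1)])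
qed

text \<open>Serves slices of a slab, reflections and dilations. Since the inner map is affine, the
  direction \<open>A h\<close> is the same at every point, so the induction hypothesis applies to
  each directional derivative.\<close>

lemma Ck_on_affine:
  assumes A: "bounded_linear A" and U: "\<And>x. x \<in> U \<Longrightarrow> A x + c \<in> S" and "Ck_on k S f"
  shows "Ck_on k U (\<lambda>x. f (A x + c))"
  using assms(3)
proof (induction k arbitrary: f)
  case 0
  have "continuous_on U (\<lambda>x. A x + c)"
    by (intro continuous_on_add linear_continuous_on A continuous_on_const)
  then show ?case using U 0 by (auto intro: continuous_on_compose2[of S f])
next
  case (Suc k)
  from Suc.prems obtain f' where *:
    "\<forall>x\<in>S. (f has_derivative f' x) (at x within S)" "\<forall>h. Ck_on k S (\<lambda>x. f' x h)"
    by auto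
  have "((\<lambda>x. f (A x + c)) has_derivative (\<lambda>h. f' (A x + c) (A h))) (at x within U)"
    if "x \<in> U" for x
  proof (rule has_derivative_in_compose2[where t=S and g=f])
    show "((\<lambda>x. A x + c) has_derivative A) (at x within U)"
      using has_derivative_add[OF bounded_linear_imp_has_derivative[OF A] has_derivative_const]
      by simp
  qed (use * U that in auto)
  moreover have "Ck_on k U (\<lambda>x. f' (A x + c) (A h))" for h
    using * by (intro Suc.IH) auto
  ultimately show ?case
    unfolding Ck_on.simps by (intro exI[of _ "\<lambda>x h. f' (A x + c) (A h)"]) blast
qed

lemma Ck_on_slice:
  assumes "Ck_on k (I \<times> UNIV) (\<lambda>(t, x). f t x)" "t \<in> I"
  shows "Ck_on k UNIV (f t)"
proof -
  have "bounded_linear (\<lambda>x::'b. (0::'a, x))"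
    by (intro bounded_linear_Pair bounded_linear_zero bounded_linear_ident)
  from Ck_on_affine[OF this _ assms(1), of UNIV "(t, 0)"] assms(2) show ?thesis
    by simp
qed

lemma Ck_on_real_derivative:
  fixes f :: "real \<Rightarrow> real"
  assumes "\<And>x. (f has_real_derivative f' x) (at x)" "Ck_on k UNIV f'"
  shows "Ck_on (Suc k) UNIV f"
proof -
  have "Ck_on k UNIV (\<lambda>x. f' x * h)" for h
    using Ck_on_bounded_linear[OF bounded_linear_mult_left assms(2)] .
  with assms(1) show ?thesis
    unfolding Ck_on.simps by (intro exI[of _ "\<lambda>x h. f' x * h"]) (auto simp: has_field_derivative_def)
qed

text \<open>The zero extension is smooth since \<open>UNIV\<close> is covered by the two open sets on which \<open>0 < t < T\<close>
  and on which \<open>\<kappa>\<close> vanishes.\<close>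

lemma Ck_on_cutoff:
  fixes \<kappa> :: "real \<Rightarrow> real" and f :: "real \<times> 'a::euclidean_space \<Rightarrow> 'b::euclidean_space"
  assumes ab: "0 < a" "b < T"
    and "Ck_on k UNIV \<kappa>" "\<And>t. t \<notin> {a..b} \<Longrightarrow> \<kappa> t = 0" "Ck_on k ({0..T} \<times> UNIV) f"
  shows "Ck_on k UNIV (\<lambda>p. \<kappa> (fst p) *\<^sub>R f p)"
  using assms(3-)
proof (induction k arbitrary: \<kappa> f)
  case 0
  let ?U = "{0<..<T} \<times> (UNIV :: 'a set)" and ?V = "(- {a..b}) \<times> (UNIV :: 'a set)"
  have UV: "?U \<union> ?V = UNIV" using ab by auto
  have "continuous_on ?U (\<lambda>p. \<kappa> (fst p) *\<^sub>R f p)"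
  proof (rule continuous_on_scaleR)
    show "continuous_on ?U (\<lambda>p. \<kappa> (fst p))"
      using 0(1) by (auto intro!: continuous_on_compose2[of UNIV \<kappa>] continuous_on_fst)
    show "continuous_on ?U f"
      using 0(3) by (auto intro: continuous_on_subset)
  qed
  moreover have "continuous_on ?V (\<lambda>p. \<kappa> (fst p) *\<^sub>R f p)"
  proof -
    have "continuous_on ?V (\<lambda>p. 0 :: 'b)" by simp
    then show ?thesis by (rule continuous_on_eq) (use 0 in auto)
  qed
  ultimately have "continuous_on (?U \<union> ?V) (\<lambda>p. \<kappa> (fst p) *\<^sub>R f p)"
    by (intro continuous_on_open_Un open_Times) (auto simp: open_Compl)
  then show ?case unfolding UV Ck_on.simps .
next
  case (Suc k)
  obtain f' where f': "\<forall>x\<in>{0..T} \<times> UNIV. (f has_derivative f' x) (at x within {0..T} \<times> UNIV)"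
    "\<forall>h. Ck_on k ({0..T} \<times> UNIV) (\<lambda>x. f' x h)"
    using Suc.prems(3) unfolding Ck_on.simps by blast
  obtain c' where c': "\<forall>x\<in>UNIV. (\<kappa> has_derivative c' x) (at x)" "\<forall>h. Ck_on k UNIV (\<lambda>x. c' x h)"
    using Suc.prems(1) unfolding Ck_on.simps by blast
  \<comment> \<open>\<open>\<kappa>\<close> is locally zero off the closed interval, so its
    derivative vanishes there as well; this is the support hypothesis of the induction for the term
    with \<open>c'\<close>.\<close>
  have c0: "c' t h = 0" if "t \<notin> {a..b}" for t h
  proof -
    have "(\<kappa> has_derivative (\<lambda>h. 0)) (at t)"
      by (rule has_derivative_transform_within_open[of "\<lambda>_. 0" _ _ _ "- {a..b}"])
        (use Suc.prems(2) that in \<open>auto simp: open_Compl\<close>)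
    with c'(1) show ?thesis using has_derivative_unique[of \<kappa> "c' t" t "\<lambda>h. 0"] by auto
  qed
  \<comment> \<open>The product rule, read globally: where \<open>f\<close> and \<open>f'\<close>
    are not controlled, the factors coming from \<open>\<kappa>\<close> are zero.\<close>
  define D where "D p h = c' (fst p) (fst h) *\<^sub>R f p + \<kappa> (fst p) *\<^sub>R f' p h" for p h
  have der: "((\<lambda>p. \<kappa> (fst p) *\<^sub>R f p) has_derivative D p) (at p)" for p
  proof (cases "fst p \<in> {a..b}")
    case True
    let ?U = "{0<..<T} \<times> (UNIV :: 'a set)"
    have "open ?U" by (intro open_Times) auto
    have pU: "p \<in> ?U" using True ab by (cases p) auto
    have fp: "(f has_derivative f' p) (at p within ?U)"
      by (rule has_derivative_subset[OF f'(1)[rule_format]]) (use pU in auto)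
    then have fp: "(f has_derivative f' p) (at p)"
      unfolding at_within_open[OF pU \<open>open ?U\<close>] .
    have "((\<lambda>p. \<kappa> (fst p)) has_derivative (\<lambda>h. c' (fst p) (fst h))) (at p)"
      by (rule has_derivative_compose[OF has_derivative_fst[OF has_derivative_ident] c'(1)[rule_format]]) simp
    from has_derivative_scaleR[OF this fp] show ?thesis
      by (simp add: D_def[abs_def] add.commute)
  next
    case False
    have "((\<lambda>p. \<kappa> (fst p) *\<^sub>R f p) has_derivative (\<lambda>h. 0)) (at p)"
    proof (rule has_derivative_transform_within_open[of "\<lambda>_. 0" _ _ _ "(- {a..b}) \<times> UNIV"])
      show "p \<in> (- {a..b}) \<times> UNIV" using False by (cases p) auto
    qed (use Suc.prems(2) in \<open>auto simp: open_Compl intro!: open_Times\<close>)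
    moreover have "D p = (\<lambda>h. 0)"
      using False by (auto simp: D_def c0 Suc.prems(2))
    ultimately show ?thesis by simp
  qed
  have "Ck_on k UNIV (\<lambda>p. D p h)" for h
    unfolding D_def
    by (intro Ck_on_add Suc.IH Ck_on_Suc_imp[OF Suc.prems(1)] Ck_on_Suc_imp[OF Suc.prems(3)]
        f'(2)[rule_format] c'(2)[rule_format] Suc.prems(2) c0)
  with der show ?case unfolding Ck_on.simps by blast
qed

section \<open>Smooth cutoffs and weak derivatives in time\<close>

text \<open>\<open>flat 0\<close> is the classical smooth but non-analytic function exp(-1/x). The
  extra powers of 1/x make the span of the family closed under differentiation, so that smoothness
  is one induction over all \<open>m\<close> at once.\<close>

definition flat :: "nat \<Rightarrow> real \<Rightarrow> real" where
  "flat m x = (if 0 < x then exp (- inverse x) * inverse x ^ m else 0)"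

lemma flat_nonneg: "0 \<le> flat m x"
  by (simp add: flat_def)

lemma flat_tendsto_0: "(flat m \<longlongrightarrow> 0) (at 0)"
proof -
  have "((\<lambda>x. inverse x ^ m / exp (inverse x)) \<longlongrightarrow> 0) (at_right (0::real))"
    by (rule filterlim_compose[OF tendsto_power_div_exp_0 filterlim_inverse_at_top_right])
  then have "(flat m \<longlongrightarrow> 0) (at_right 0)"
    by (rule Lim_transform_eventually)
      (auto simp: eventually_at_right_field flat_def exp_minus field_simps intro!: exI[of _ 1])
  moreover have "(flat m \<longlongrightarrow> 0) (at_left 0)"
    by (rule Lim_transform_eventually[OF tendsto_const])
      (auto simp: eventually_at_left_field flat_def intro!: exI[of _ "-1"])
  ultimately show ?thesis by (simp add: filterlim_split_at)
qed

lemma flat_derivative: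
  "(flat m has_real_derivative flat (m + 2) x - real m * flat (m + 1) x) (at x)"
proof -
  consider "0 < x" | "x < 0" | "x = 0" by linarith
  then show ?thesis
  proof cases
    case 1
    have "((\<lambda>x. exp (- inverse x) * inverse x ^ m) has_real_derivative
        flat (m + 2) x - real m * flat (m + 1) x) (at x)"
    proof -
      have inv: "(inverse has_real_derivative - (inverse x ^ 2)) (at x)"
        using DERIV_inverse[of x] 1 by (simp add: numeral_2_eq_2)
      from DERIV_chain'[OF DERIV_minus[OF inv] DERIV_exp]
      have "((\<lambda>x. exp (- inverse x)) has_real_derivative exp (- inverse x) * inverse x ^ 2) (at x)"
        by simp
      from DERIV_mult[OF this DERIV_power[OF inv, of m]] show ?thesis
        by (rule DERIV_cong) (use 1 in \<open>cases m; simp add: flat_def algebra_simps power2_eq_square\<close>)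
    qed
    then show ?thesis
      by (rule has_field_derivative_transform_within_open[where S="{0<..}"])
        (use 1 in \<open>auto simp: flat_def\<close>)
  next
    case 2
    have "((\<lambda>x. 0) has_real_derivative 0) (at x)" by simp
    then have "(flat m has_real_derivative 0) (at x)"
      by (rule has_field_derivative_transform_within_open[where S="{..<0}"])
        (use 2 in \<open>auto simp: flat_def\<close>)
    then show ?thesis using 2 by (simp add: flat_def)
  next
    case 3
    \<comment> \<open>At 0 the difference quotient of \<open>flat m\<close> is
      \<open>flat (m + 1)\<close> itself, so \<open>flat_tendsto_0\<close> gives the
      derivative.\<close>
    have "((\<lambda>h. (flat m (0 + h) - flat m 0) / h) \<longlongrightarrow> 0) (at 0)"
      by (rule Lim_transform_eventually[OF flat_tendsto_0[of "m + 1"]])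
        (auto simp: eventually_at_filter flat_def field_simps)
    then show ?thesis using 3 by (simp add: DERIV_def flat_def)
  qed
qed

lemma Ck_on_flat: "Ck_on k UNIV (flat m)"
proof (induction k arbitrary: m)
  case 0
  show ?case
    using flat_derivative by (auto simp: continuous_on_eq_continuous_within intro: DERIV_continuous)
next
  case (Suc k)
  have "Ck_on k UNIV (\<lambda>x. flat (m + 2) x + (- real m) *\<^sub>R flat (m + 1) x)"
    by (intro Ck_on_add Suc.IH Ck_on_bounded_linear[OF bounded_linear_scaleR_right])
  then show ?case
    by (intro Ck_on_real_derivative[OF flat_derivative]) simp
qed

text \<open>The step is the normalised antiderivative of the bump
  \<open>flat 0 x * flat 0 (1 - x)\<close>, which is positive exactly on the open unit
  interval.\<close>

lemma smooth_step_exists: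
  obtains \<Phi> \<rho> :: "real \<Rightarrow> real" where
    "\<And>x. (\<Phi> has_real_derivative \<rho> x) (at x)" "\<And>k. Ck_on k UNIV \<rho>"
    "\<And>x. x \<le> 0 \<Longrightarrow> \<Phi> x = 0" "\<And>x. 1 \<le> x \<Longrightarrow> \<Phi> x = 1"
    "\<And>x. 0 \<le> \<rho> x" "\<And>x. x \<notin> {0..1} \<Longrightarrow> \<rho> x = 0" "\<And>x. 0 \<le> \<Phi> x" "\<And>x. \<Phi> x \<le> 1"
proof -
  define \<rho> where "\<rho> x = flat 0 x * flat 0 (1 - x)" for x
  have Ck: "Ck_on k UNIV \<rho>" for k
  proof -
    have "Ck_on k UNIV (\<lambda>x. flat 0 (- x + 1))"
      by (rule Ck_on_affine[OF _ _ Ck_on_flat]) (auto intro: bounded_linear_minus bounded_linear_ident)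
    from Ck_on_bounded_bilinear[OF bounded_bilinear_mult Ck_on_flat[of k 0] this]
    show ?thesis by (simp add: \<rho>_def[abs_def])
  qed
  have "isCont \<rho> x" for x
    using Ck[of 0] by (simp add: continuous_on_eq_continuous_at)
  then obtain F where F: "\<And>x. (F has_real_derivative \<rho> x) (at x)"
    using einterval_antiderivative[of "-\<infinity>" "\<infinity>" \<rho>]
    by (auto simp: has_real_derivative_iff_has_vector_derivative)
  have \<rho>0: "0 \<le> \<rho> x" for x by (simp add: \<rho>_def flat_nonneg)
  have mono: "F x \<le> F y" if "x \<le> y" for x y
    by (rule DERIV_nonneg_imp_nondecreasing[OF that]) (use F \<rho>0 in blast)
  have left: "F x = F 0" if "x \<le> 0" for x
  proof (cases "x = 0")
    case False
    have "\<exists>z. x < z \<and> z < 0 \<and> F 0 - F x = (0 - x) * \<rho> z"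
      by (rule MVT2) (use F False that in auto)
    then show ?thesis by (auto simp: \<rho>_def flat_def)
  qed simp
  have right: "F x = F 1" if "1 \<le> x" for x
  proof (cases "x = 1")
    case False
    have "\<exists>z. 1 < z \<and> z < x \<and> F x - F 1 = (x - 1) * \<rho> z"
      by (rule MVT2) (use F False that in auto)
    then show ?thesis by (auto simp: \<rho>_def flat_def)
  qed simp
  \<comment> \<open>The mean value theorem exhibits the mass of the bump as one of its positive
    values, so it may be divided out.\<close>
  have "\<exists>z. 0 < z \<and> z < 1 \<and> F 1 - F 0 = (1 - 0) * \<rho> z"
    by (rule MVT2) (use F in auto)
  then obtain z where "0 < z" "z < 1" "F 1 - F 0 = \<rho> z" by auto
  then have I: "0 < F 1 - F 0" by (simp add: \<rho>_def flat_def)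
  define c where "c = inverse (F 1 - F 0)"
  have c: "0 < c" "(F 1 - F 0) * c = 1" using I by (auto simp: c_def)
  show thesis
  proof (rule that[of "\<lambda>x. (F x - F 0) * c" "\<lambda>x. \<rho> x * c"])
    show "((\<lambda>x. (F x - F 0) * c) has_real_derivative \<rho> x * c) (at x)" for x
      using DERIV_cmult_right[OF DERIV_diff[OF F DERIV_const]] by simp
    show "Ck_on k UNIV (\<lambda>x. \<rho> x * c)" for k
      by (rule Ck_on_bounded_linear[OF bounded_linear_mult_left Ck])
    show "\<rho> x * c = 0" if "x \<notin> {0..1}" for x
      using that by (auto simp: \<rho>_def flat_def)
    have "F 0 \<le> F x" "F x \<le> F 1" for x
      using mono[of 0 x] mono[of x 1] left[of x] right[of x] I by linarith+
    then show "0 \<le> (F x - F 0) * c" "(F x - F 0) * c \<le> 1" for x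
      using c I mult_right_mono[of "F x - F 0" "F 1 - F 0" c] by auto
    show "(F x - F 0) * c = 0" if "x \<le> 0" for x using left[OF that] by simp
    show "(F x - F 0) * c = 1" if "1 \<le> x" for x using right[OF that] c(2) by simp
    show "0 \<le> \<rho> x * c" for x using \<rho>0 c(1) by simp
  qed
qed

text \<open>A weighted mean of values within \<open>e\<close> of \<open>A\<close> is within
  \<open>e\<close> of \<open>A\<close>. The unit mass of the weight \<open>\<psi>\<close> is
  expressed through an antiderivative \<open>\<phi>\<close>, so that it can be read off at the
  endpoints.\<close>

lemma approximate_identity_bound:
  fixes \<phi> :: "real \<Rightarrow> real"
  assumes der: "\<And>x. (\<phi> has_real_derivative \<psi> x) (at x)" and cont: "continuous_on UNIV \<psi>"
    and nonneg: "\<And>x. 0 \<le> \<psi> x" and T: "0 \<le> T" "\<phi> T - \<phi> 0 = 1"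
    and g: "continuous_on {0..T} g"
    and close: "\<And>x. x \<in> {0..T} \<Longrightarrow> \<psi> x \<noteq> 0 \<Longrightarrow> \<bar>g x - A\<bar> \<le> e"
  shows "\<bar>(LINT x:{0..T}|lborel. \<psi> x * g x) - A\<bar> \<le> e"
proof -
  have cont': "continuous_on {0..T} \<psi>" using cont by (rule continuous_on_subset) auto
  have one: "(\<psi> has_integral 1) {0..T}"
    unfolding T(2)[symmetric]
    by (rule fundamental_theorem_of_calculus)
      (use T der in \<open>auto simp: has_real_derivative_iff_has_vector_derivative
        intro: has_vector_derivative_at_within\<close>)
  have "set_integrable lborel {0..T} (\<lambda>x. \<psi> x * g x)"
    by (intro borel_integrable_atLeastAtMost' continuous_intros cont' g)
  then have "(LINT x:{0..T}|lborel. \<psi> x * g x) = integral {0..T} (\<lambda>x. \<psi> x * g x)"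
    by (rule set_borel_integral_eq_integral)
  then have "(LINT x:{0..T}|lborel. \<psi> x * g x) - A =
      integral {0..T} (\<lambda>x. \<psi> x * g x) - integral {0..T} (\<lambda>x. \<psi> x * A)"
    using integral_unique[OF one] by simp
  also have "\<dots> = integral {0..T} (\<lambda>x. \<psi> x * (g x - A))"
    by (subst integral_diff[symmetric])
      (auto simp: algebra_simps intro!: integrable_continuous_interval continuous_intros cont' g)
  also have "norm \<dots> \<le> integral {0..T} (\<lambda>x. \<psi> x * e)"
  proof (rule integral_norm_bound_integral)
    fix x assume "x \<in> {0..T}"
    then show "norm (\<psi> x * (g x - A)) \<le> \<psi> x * e"
      using close[of x] nonneg[of x]
      by (cases "\<psi> x = 0") (auto simp: abs_mult intro: mult_left_mono)
  qed (auto intro!: integrable_continuous_interval continuous_intros cont' g)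
  also have "\<dots> = e"
    using integral_unique[OF one] by simp
  finally show ?thesis by simp
qed

text \<open>The kernel lives on \<open>[a - \<sigma> / n, a + (1 - \<sigma>) / n]\<close>, and the
  assumption \<open>ev\<close> says that this interval eventually lies in \<open>[0, T]\<close>. The
  offset \<open>\<sigma>\<close> lets one statement serve both ends of a time interval: the kernel
  can sit to the right or to the left of \<open>a\<close>.\<close>

lemma approximate_identity_limit:
  fixes \<Phi> \<rho> :: "real \<Rightarrow> real"
  assumes der: "\<And>x. (\<Phi> has_real_derivative \<rho> x) (at x)" and cont: "continuous_on UNIV \<rho>"
    and 0: "\<And>x. x \<le> 0 \<Longrightarrow> \<Phi> x = 0" and 1: "\<And>x. 1 \<le> x \<Longrightarrow> \<Phi> x = 1"
    and nonneg: "\<And>x. 0 \<le> \<rho> x" and supp: "\<And>x. x \<notin> {0..1} \<Longrightarrow> \<rho> x = 0"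
    and g: "continuous_on {0..T} g" and a: "a \<in> {0..T}"
    and ev: "\<forall>\<^sub>F n in sequentially. \<sigma> \<le> real n * a \<and> 1 - \<sigma> \<le> real n * (T - a)"
  shows "(\<lambda>n. LINT x:{0..T}|lborel. (real n * \<rho> (real n * (x - a) + \<sigma>)) * g x) \<longlonglongrightarrow> g a"
proof (rule tendstoI)
  fix e :: real assume e: "0 < e"
  then obtain d where d: "0 < d" "\<And>x. x \<in> {0..T} \<Longrightarrow> dist x a < d \<Longrightarrow> dist (g x) (g a) < e / 2"
    using g[unfolded continuous_on_iff, rule_format, OF a half_gt_zero[OF e]] by blast
  \<comment> \<open>For such \<open>n\<close> the support of the kernel is within distance
    \<open>d\<close> of \<open>a\<close>.\<close>
  have "\<forall>\<^sub>F n in sequentially. (1 + \<bar>\<sigma>\<bar>) / d < real n"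
    using filterlim_real_sequentially by (auto simp: filterlim_at_top_dense)
  with ev show "\<forall>\<^sub>F n in sequentially.
      dist (LINT x:{0..T}|lborel. (real n * \<rho> (real n * (x - a) + \<sigma>)) * g x) (g a) < e"
  proof eventually_elim
    case (elim n)
    have n: "0 < real n" using elim(2) d(1)
      by (meson abs_ge_zero add_nonneg_nonneg divide_nonneg_pos le_less_trans zero_le_one)
    have "\<bar>(LINT x:{0..T}|lborel. (real n * \<rho> (real n * (x - a) + \<sigma>)) * g x) - g a\<bar> \<le> e / 2"
    proof (rule approximate_identity_bound)
      show "((\<lambda>x. \<Phi> (real n * (x - a) + \<sigma>)) has_real_derivative
          real n * \<rho> (real n * (x - a) + \<sigma>)) (at x)" for x
        by (rule DERIV_chain'[THEN DERIV_cong, OF _ der]) (auto intro!: derivative_eq_intros)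
      show "continuous_on UNIV (\<lambda>x. real n * \<rho> (real n * (x - a) + \<sigma>))"
        by (intro continuous_on_mult continuous_on_const continuous_on_compose2[OF cont]
            continuous_on_add continuous_on_diff continuous_on_id) auto
      show "\<Phi> (real n * (T - a) + \<sigma>) - \<Phi> (real n * (0 - a) + \<sigma>) = 1"
        using elim(1) by (simp add: 0 1)
      fix x assume x: "x \<in> {0..T}" "real n * \<rho> (real n * (x - a) + \<sigma>) \<noteq> 0"
      then have "real n * (x - a) + \<sigma> \<in> {0..1}" using supp by fastforce
      then have "\<bar>real n * (x - a)\<bar> \<le> 1 + \<bar>\<sigma>\<bar>" by auto
      also have "\<dots> < real n * d" using elim(2) d(1) by (simp add: field_simps)
      finally have "\<bar>x - a\<bar> < d" using n by (simp add: abs_mult)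
      then show "\<bar>g x - g a\<bar> \<le> e / 2"
        using d(2)[OF x(1)] by (auto simp: dist_real_def)
    qed (use nonneg a g in auto)
    then show ?case using e by (simp add: dist_real_def)
  qed
qed

lemma set_integrable_continuous_mult:
  fixes c f :: "real \<Rightarrow> real"
  assumes c: "continuous_on {a..b} c" and f: "set_integrable lborel {a..b} f"
  shows "set_integrable lborel {a..b} (\<lambda>x. c x * f x)"
proof -
  have "compact (c ` {a..b})"
    by (rule compact_continuous_image[OF c]) auto
  then have "\<exists>K. \<forall>x\<in>{a..b}. norm (c x) \<le> K"
    by (auto dest!: compact_imp_bounded simp: bounded_iff)
  then obtain K where K: "\<And>x. x \<in> {a..b} \<Longrightarrow> norm (c x) \<le> K" by blast
  have intK: "set_integrable lborel {a..b} (\<lambda>x. K * f x)"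
    using f by (rule set_integrable_mult_right)
  have "(\<lambda>x. indicator {a..b} x *\<^sub>R c x) \<in> borel_measurable lborel"
    using borel_measurable_continuous_on_indicator[OF _ c] by simp
  moreover have "(\<lambda>x. indicator {a..b} x *\<^sub>R f x) \<in> borel_measurable lborel"
    using f unfolding set_integrable_def by (rule borel_measurable_integrable)
  ultimately have "(\<lambda>x. (indicator {a..b} x *\<^sub>R c x) * (indicator {a..b} x *\<^sub>R f x)) \<in> borel_measurable lborel"
    by (rule borel_measurable_times)
  moreover have "(\<lambda>x. (indicator {a..b} x *\<^sub>R c x) * (indicator {a..b} x *\<^sub>R f x)) =
      (\<lambda>x. indicator {a..b} x *\<^sub>R (c x * f x))"
    by (auto simp: fun_eq_iff indicator_def)
  ultimately have "set_borel_measurable lborel {a..b} (\<lambda>x. c x * f x)"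
    by (simp add: set_borel_measurable_def)
  moreover have "AE x in lborel. x \<in> {a..b} \<longrightarrow> norm (c x * f x) \<le> norm (K * f x)"
  proof (intro AE_I2 impI)
    fix x assume x: "x \<in> {a..b}"
    have "0 \<le> K" using K[OF x] norm_ge_zero[of "c x"] by linarith
    then show "norm (c x * f x) \<le> norm (K * f x)"
      using mult_right_mono[OF K[OF x], of "norm (f x)"] by (simp add: abs_mult)
  qed
  ultimately show ?thesis by (rule set_integrable_bound[OF intK])
qed

text \<open>Test with smooth approximations of the indicator of \<open>{0..t}\<close>, built from one smooth step rescaled
  at both ends.\<close>

lemma weak_derivative_integral:
  fixes g h :: "real \<Rightarrow> real"
  assumes g: "continuous_on {0..T} g" and h: "set_integrable lborel {0..T} h"
    and weak: "\<And>\<kappa> \<kappa>' a b. 0 < a \<Longrightarrow> b < T \<Longrightarrow> (\<And>k. Ck_on k UNIV \<kappa>) \<Longrightarrow>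
      (\<And>x. (\<kappa> has_real_derivative \<kappa>' x) (at x)) \<Longrightarrow> continuous_on UNIV \<kappa>' \<Longrightarrow> (\<And>x. x \<notin> {a..b} \<Longrightarrow> \<kappa> x = 0) \<Longrightarrow>
      (LINT x:{0..T}|lborel. \<kappa>' x * g x + \<kappa> x * h x) = 0"
    and t: "t \<in> {0..T}"
  shows "g t - g 0 = (LINT x:{0..t}|lborel. h x)"
proof (cases "t = 0")
  case True
  have "(LINT x:{0..0}|lborel. h x) = 0"
    unfolding set_lebesgue_integral_def
    by (rule integral_eq_zero_AE, rule AE_mp[OF AE_lborel_singleton[of 0]]) auto
  then show ?thesis using True by simp
next
  case False
  then have t0: "0 < t" "t \<le> T" using t by auto
  obtain \<Phi> \<rho> :: "real \<Rightarrow> real" where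
    der: "\<And>x. (\<Phi> has_real_derivative \<rho> x) (at x)" and Ck: "\<And>k. Ck_on k UNIV \<rho>"
    and P0: "\<And>x. x \<le> 0 \<Longrightarrow> \<Phi> x = 0" and P1: "\<And>x. 1 \<le> x \<Longrightarrow> \<Phi> x = 1"
    and \<rho>: "\<And>x. 0 \<le> \<rho> x" "\<And>x. x \<notin> {0..1} \<Longrightarrow> \<rho> x = 0"
    and P01: "\<And>x. 0 \<le> \<Phi> x" "\<And>x. \<Phi> x \<le> 1"
    by (rule smooth_step_exists, rule that)
  have contr: "continuous_on UNIV \<rho>" using Ck[of 0] by simp
  have contP: "continuous_on UNIV \<Phi>"
    using der by (auto simp: continuous_on_eq_continuous_at intro: DERIV_continuous)
  have CkP: "Ck_on k UNIV \<Phi>" for k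
    by (rule Ck_on_Suc_imp[OF Ck_on_real_derivative[OF der Ck]])
  \<comment> \<open>For large \<open>n\<close> this rises on \<open>[1/n, 2/n]\<close> and falls on
    \<open>[t - 2/n, t - 1/n]\<close>. The offsets \<open>-1\<close> and \<open>2\<close> keep the
    support strictly inside \<open>(0, T)\<close>, even for \<open>t = T\<close>.\<close>
  define \<eta> where "\<eta> n x = \<Phi> (real n * (x - 0) + (-1)) - \<Phi> (real n * (x - t) + 2)" for n x
  define \<eta>' where "\<eta>' n x = real n * \<rho> (real n * (x - 0) + (-1)) - real n * \<rho> (real n * (x - t) + 2)"
    for n x
  have der\<eta>: "(\<eta> n has_real_derivative \<eta>' n x) (at x)" for n x
    unfolding \<eta>_def[abs_def] \<eta>'_def
    by (intro DERIV_diff) (rule DERIV_chain'[THEN DERIV_cong, OF _ der], auto intro!: derivative_eq_intros)+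
  have cont\<eta>': "continuous_on UNIV (\<eta>' n)" for n
    unfolding \<eta>'_def[abs_def]
    by (intro continuous_on_diff continuous_on_mult continuous_on_const continuous_on_compose2[OF contr]
        continuous_on_add continuous_on_id) auto
  have Ck\<eta>: "Ck_on k UNIV (\<eta> n)" for k n
  proof -
    have *: "Ck_on k UNIV (\<lambda>x. \<Phi> (real n * x + c))" for c
      by (rule Ck_on_affine[OF bounded_linear_mult_right _ CkP]) auto
    have "Ck_on k UNIV (\<lambda>x. \<Phi> (real n * x + (-1)) + (- \<Phi> (real n * x + (2 - real n * t))))"
      by (intro Ck_on_add * Ck_on_bounded_linear[OF bounded_linear_minus[OF bounded_linear_ident]])
    then show ?thesis by (simp add: \<eta>_def[abs_def] algebra_simps)
  qed
  have "\<forall>\<^sub>F n in sequentially. 3 / t < real n"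
    using filterlim_real_sequentially by (auto simp: filterlim_at_top_dense)
  \<comment> \<open>With \<open>n t > 3\<close> the fall has not begun where the rise has not, and
    the rise is over where the fall is. This is enough for the support; an overlap of the two
    transition zones does no harm.\<close>
  then have ev: "\<forall>\<^sub>F n in sequentially. 0 < real n \<and> 3 < real n * t"
  proof eventually_elim
    case (elim n)
    have "0 < real n" using elim t0 by (meson divide_pos_pos less_trans zero_less_numeral)
    then show ?case using elim t0 by (simp add: field_simps)
  qed
  have zero: "\<eta> n x = 0" if "0 < real n" "3 < real n * t" "x \<notin> {1 / real n .. t - 1 / real n}" for n x
  proof (cases "x < 1 / real n")
    case True
    then have "real n * x < 1" using that by (simp add: field_simps)
    moreover have "real n * (x - t) + 2 \<le> 0" using calculation that by (simp add: algebra_simps)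
    ultimately show ?thesis by (simp add: \<eta>_def P0)
  next
    case False
    then have "t - 1 / real n < x" using that(3) by auto
    then have "real n * (t - 1 / real n) < real n * x"
      using that(1) by (rule mult_strict_left_mono)
    then have "real n * t - 1 < real n * x" using that(1) by (simp add: right_diff_distrib)
    then have "1 \<le> real n * (x - t) + 2" "2 \<le> real n * x" using that
      by (auto simp: algebra_simps)
    then show ?thesis by (simp add: \<eta>_def P1)
  qed
  have int_g: "set_integrable lborel {0..T} (\<lambda>x. (real n * \<rho> (real n * (x - a) + c)) * g x)" for n a c
    by (intro borel_integrable_atLeastAtMost' continuous_on_mult g continuous_on_const
        continuous_on_compose2[OF contr] continuous_on_add continuous_on_diff continuous_on_id) auto
  have cont\<eta>: "continuous_on UNIV (\<eta> n)" for n using Ck\<eta>[of 0 n] by simp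
  have bound: "norm (\<eta> n x * h x) \<le> norm (h x)" for n x
  proof -
    have "\<bar>\<eta> n x\<bar> \<le> 1"
      using P01[of "real n * (x - 0) + (-1)"] P01[of "real n * (x - t) + 2"] by (auto simp: \<eta>_def)
    then show ?thesis by (simp add: abs_mult mult_left_le_one_le)
  qed
  have int_h: "set_integrable lborel {0..T} (\<lambda>x. \<eta> n x * h x)" for n
    by (intro set_integrable_continuous_mult h continuous_on_subset[OF cont\<eta>]) auto
  have "\<forall>\<^sub>F n in sequentially. (LINT x:{0..T}|lborel. \<eta> n x * h x) =
      (LINT x:{0..T}|lborel. (real n * \<rho> (real n * (x - t) + 2)) * g x) -
      (LINT x:{0..T}|lborel. (real n * \<rho> (real n * (x - 0) + (-1))) * g x)"
    using ev
  proof eventually_elim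
    case (elim n)
    have n: "0 < 1 / real n" using elim by simp
    then have "t - 1 / real n < T" using t0 by linarith
    from weak[OF n this Ck\<eta> der\<eta> cont\<eta>' zero] elim
    have 0: "(LINT x:{0..T}|lborel. \<eta>' n x * g x + \<eta> n x * h x) = 0" by auto
    have eq: "\<eta>' n x * g x = (real n * \<rho> (real n * (x - 0) + (-1))) * g x -
        (real n * \<rho> (real n * (x - t) + 2)) * g x" for x
      by (simp only: \<eta>'_def left_diff_distrib)
    have "(LINT x:{0..T}|lborel. \<eta>' n x * g x + \<eta> n x * h x) =
      (LINT x:{0..T}|lborel. \<eta>' n x * g x) + (LINT x:{0..T}|lborel. \<eta> n x * h x)"
      unfolding eq by (intro set_integral_add(2) set_integral_diff(1) int_g int_h)
    moreover have "(LINT x:{0..T}|lborel. \<eta>' n x * g x) =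
      (LINT x:{0..T}|lborel. (real n * \<rho> (real n * (x - 0) + (-1))) * g x) -
      (LINT x:{0..T}|lborel. (real n * \<rho> (real n * (x - t) + 2)) * g x)"
      unfolding eq by (intro set_integral_diff(2) int_g)
    ultimately show ?case using 0 by simp
  qed
  \<comment> \<open>The two halves of \<open>\<eta>' n\<close> are approximate identities at
    \<open>0\<close> and at \<open>t\<close>, so continuity of \<open>g\<close> suffices for the
    limit.\<close>
  moreover have "(\<lambda>n. (LINT x:{0..T}|lborel. (real n * \<rho> (real n * (x - t) + 2)) * g x) -
      (LINT x:{0..T}|lborel. (real n * \<rho> (real n * (x - 0) + (-1))) * g x)) \<longlonglongrightarrow> g t - g 0"
  proof (intro tendsto_diff approximate_identity_limit[OF der contr P0 P1 \<rho> g])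
    show "\<forall>\<^sub>F n in sequentially. 2 \<le> real n * t \<and> 1 - 2 \<le> real n * (T - t)"
      using ev by eventually_elim (use t0 in \<open>auto intro: order_trans[of _ 0]\<close>)
    show "\<forall>\<^sub>F n in sequentially. - 1 \<le> real n * 0 \<and> 1 - - 1 \<le> real n * (T - 0)"
      using ev
    proof eventually_elim
      case (elim n)
      have "real n * t \<le> real n * T" by (rule mult_left_mono) (use t0 in auto)
      then have "2 \<le> real n * T" using elim by linarith
      then show ?case by simp
    qed
  qed (use t0 in auto)
  ultimately have "(\<lambda>n. LINT x:{0..T}|lborel. \<eta> n x * h x) \<longlonglongrightarrow> g t - g 0"
    by (elim Lim_transform_eventually eventually_mono) simp
  moreover have "(\<lambda>n. LINT x:{0..T}|lborel. \<eta> n x * h x) \<longlonglongrightarrow> (LINT x:{0..t}|lborel. h x)"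
    unfolding set_lebesgue_integral_def
  proof (rule integral_dominated_convergence[where w="\<lambda>x. norm (indicator {0..T} x *\<^sub>R h x)"])
    have "set_integrable lborel {0..t} h"
      by (rule set_integrable_subset[OF h]) (use t0 in auto)
    then show "(\<lambda>x. indicator {0..t} x *\<^sub>R h x) \<in> borel_measurable lborel"
      unfolding set_integrable_def by (rule borel_measurable_integrable)
    show "(\<lambda>x. indicator {0..T} x *\<^sub>R (\<eta> n x * h x)) \<in> borel_measurable lborel" for n
      using int_h[of n] unfolding set_integrable_def by (rule borel_measurable_integrable)
    show "integrable lborel (\<lambda>x. norm (indicator {0..T} x *\<^sub>R h x))"
      using h unfolding set_integrable_def by (rule integrable_norm)
    show "AE x in lborel. norm (indicator {0..T} x *\<^sub>R (\<eta> n x * h x)) \<le>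
        norm (indicator {0..T} x *\<^sub>R h x)" for n
      unfolding norm_scaleR by (intro AE_I2 mult_left_mono bound) auto
    \<comment> \<open>For large \<open>n\<close>, \<open>\<eta> n\<close> vanishes at
      \<open>0\<close> and at \<open>t\<close>, where the indicator of the closed interval is 1;
      hence these two points are left out, a null set.\<close>
    have lim: "(\<lambda>n. indicator {0..T} x *\<^sub>R (\<eta> n x * h x)) \<longlonglongrightarrow> indicator {0..t} x *\<^sub>R h x"
      if x: "x \<notin> {0, t}" for x
    proof (rule Lim_transform_eventually[OF tendsto_const])
      have "\<forall>\<^sub>F n in sequentially. 2 / \<bar>x\<bar> < real n" "\<forall>\<^sub>F n in sequentially. 2 / \<bar>x - t\<bar> < real n"
        using filterlim_real_sequentially by (auto simp: filterlim_at_top_dense)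
      then show "\<forall>\<^sub>F n in sequentially.
          indicator {0..t} x *\<^sub>R h x = indicator {0..T} x *\<^sub>R (\<eta> n x * h x)"
        using ev
      proof eventually_elim
        case (elim n)
        have *: "2 < real n * \<bar>x\<bar>" "2 < real n * \<bar>x - t\<bar>" using elim x
          by (auto simp: divide_less_eq)
        show ?case
        proof (cases "x \<in> {0..t}")
          case True
          then have "\<eta> n x = 1" using * by (auto simp: \<eta>_def P0 P1 algebra_simps)
          then show ?thesis using True t0 by (simp add: indicator_def)
        next
          case False
          have "\<eta> n x = 0"
          proof (cases "x < 0")
            case True
            then have "real n * x < 0" using elim by (simp add: mult_pos_neg)
            then show ?thesis using elim by (simp add: \<eta>_def P0 algebra_simps)
          next
            case False
            then have "real n * (x - t) > 2" using * \<open>x \<notin> {0..t}\<close> by auto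
            then show ?thesis using elim by (simp add: \<eta>_def P1 algebra_simps)
          qed
          then show ?thesis using False by simp
        qed
      qed
    qed
    have "AE x in lborel. x \<notin> {0, t}"
      by (intro AE_not_in countable_imp_null_set_lborel) auto
    then show "AE x in lborel. (\<lambda>n. indicator {0..T} x *\<^sub>R (\<eta> n x * h x)) \<longlonglongrightarrow>
        indicator {0..t} x *\<^sub>R h x"
      by (rule eventually_mono) (rule lim)
  qed
  ultimately show ?thesis by (rule LIMSEQ_unique)
qed

text \<open>\<open>G\<close> need not be differentiable, so the weight is moved onto the test
  function: \<open>\<kappa> x * exp (- r * x)\<close> is again an admissible cutoff, and its
  derivative produces the term \<open>- r * G\<close>.\<close>

lemma weak_derivative_integral_exp:
  fixes G H :: "real \<Rightarrow> real"
  assumes G: "continuous_on {0..T} G" and H: "set_integrable lborel {0..T} H"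
    and weak: "\<And>\<kappa> \<kappa>' a b. 0 < a \<Longrightarrow> b < T \<Longrightarrow> (\<And>k. Ck_on k UNIV \<kappa>) \<Longrightarrow>
      (\<And>x. (\<kappa> has_real_derivative \<kappa>' x) (at x)) \<Longrightarrow> continuous_on UNIV \<kappa>' \<Longrightarrow>
      (\<And>x. x \<notin> {a..b} \<Longrightarrow> \<kappa> x = 0) \<Longrightarrow> (LINT x:{0..T}|lborel. \<kappa>' x * G x + \<kappa> x * H x) = 0"
    and t: "t \<in> {0..T}"
  shows "set_integrable lborel {0..T} (\<lambda>s. exp (- r * s) * (H s - r * G s))"
    and "exp (- r * t) * G t - G 0 = (LINT s:{0..t}|lborel. exp (- r * s) * (H s - r * G s))"
proof -
  let ?e = "\<lambda>s :: real. exp (- r * s)"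
  have Cke: "Ck_on k UNIV (\<lambda>s. c * ?e s)" for k c
  proof (induction k arbitrary: c)
    case 0
    then show ?case by (auto intro!: continuous_intros)
  next
    case (Suc k)
    have "((\<lambda>s. c * ?e s) has_real_derivative (- r * c) * ?e s) (at s)" for s
      by (auto intro!: derivative_eq_intros)
    then show ?case by (rule Ck_on_real_derivative) (rule Suc)
  qed
  show int: "set_integrable lborel {0..T} (\<lambda>s. ?e s * (H s - r * G s))"
    by (intro set_integrable_continuous_mult continuous_intros set_integral_diff(1) H
        borel_integrable_atLeastAtMost' G)
  have "?e t * G t - ?e 0 * G 0 = (LINT s:{0..t}|lborel. ?e s * (H s - r * G s))"
  proof (rule weak_derivative_integral[OF _ int _ t])
    show "continuous_on {0..T} (\<lambda>s. ?e s * G s)"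
      by (intro continuous_intros G)
    fix \<kappa> \<kappa>' a b
    assume k: "0 < a" "b < T" "\<And>k. Ck_on k UNIV \<kappa>" "\<And>x. (\<kappa> has_real_derivative \<kappa>' x) (at x)"
      "continuous_on UNIV \<kappa>'" "\<And>x. x \<notin> {a..b} \<Longrightarrow> \<kappa> x = 0"
    have cont: "continuous_on UNIV \<kappa>" using k(3)[of 0] by simp
    have "(LINT x:{0..T}|lborel. (\<kappa>' x * ?e x + (- r * ?e x) * \<kappa> x) * G x + (\<kappa> x * ?e x) * H x) = 0"
    proof (rule weak[OF k(1,2)])
      show "Ck_on k UNIV (\<lambda>x. \<kappa> x * ?e x)" for k
        using Ck_on_bounded_bilinear[OF bounded_bilinear_mult k(3) Cke[of k 1]] by simp
      show "((\<lambda>x. \<kappa> x * ?e x) has_real_derivative \<kappa>' x * ?e x + (- r * ?e x) * \<kappa> x) (at x)" for x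
        by (rule DERIV_mult[OF k(4)]) (auto intro!: derivative_eq_intros)
      show "continuous_on UNIV (\<lambda>x. \<kappa>' x * ?e x + (- r * ?e x) * \<kappa> x)"
        by (intro continuous_intros k(5) cont)
      show "\<kappa> x * ?e x = 0" if "x \<notin> {a..b}" for x using k(6)[OF that] by simp
    qed
    then show "(LINT x:{0..T}|lborel. \<kappa>' x * (?e x * G x) + \<kappa> x * (?e x * (H x - r * G x))) = 0"
      by (simp add: algebra_simps)
  qed
  then show "?e t * G t - G 0 = (LINT s:{0..t}|lborel. ?e s * (H s - r * G s))" by simp
qed

section \<open>Integration by parts on the torus\<close>

lemma periodic_axis: "periodic f \<Longrightarrow> f (x + axis j 1) = f x"
  unfolding periodic_def by (drule spec[of _ x], drule spec[of _ "axis j 1"]) (simp add: axis_def)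

text \<open>Links the Bochner integral over \<open>torus\<close> with the gauge integral over the
  cube, for which box splitting, translation and differentiation under the integral are used
  below.\<close>

lemma integral_torus_continuous:
  fixes f :: "real^'n \<Rightarrow> 'b::euclidean_space"
  assumes "continuous_on (cbox 0 1) f"
  shows "integrable torus f" "(LINT x|torus. f x) = integral (cbox 0 1) f"
proof -
  have *: "set_integrable lborel (cbox 0 1) f"
    unfolding set_integrable_def by (rule borel_integrable_compact[OF compact_cbox assms])
  have sets: "cbox 0 1 \<inter> space lborel \<in> sets (lborel :: (real^'n) measure)" by simp
  show "integrable torus f"
    using * unfolding torus_def integrable_restrict_space[OF sets] set_integrable_def .
  show "(LINT x|torus. f x) = integral (cbox 0 1) f"
    using set_borel_integral_eq_integral(2)[OF *]
    unfolding torus_def integral_restrict_space[OF sets] set_lebesgue_integral_def .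
qed

text \<open>The part of the shifted cube with \<open>x $ j > 1\<close> is moved back by one period.\<close>

lemma integral_cube_shift:
  fixes f :: "real^'n \<Rightarrow> real"
  assumes per: "periodic f" and cont: "continuous_on UNIV f" and h: "h \<in> {0..1}"
  shows "integral (cbox 0 1) (\<lambda>x. f (x + h *\<^sub>R axis j 1)) = integral (cbox 0 1) f"
proof -
  let ?e = "axis j 1 :: real^'n"
  have int: "f integrable_on cbox a b" for a b
    by (rule integrable_continuous) (use cont in \<open>auto intro: continuous_on_subset\<close>)
  have e: "?e \<in> Basis" by simp
  have inner: "x \<bullet> ?e = x $ j" for x by (simp add: inner_axis)
  have ax: "?e $ i = (if i = j then 1 else 0)" for i by (simp add: axis_def)
  \<comment> \<open>All boxes below agree in every coordinate other than \<open>j\<close>; isolating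
    that coordinate reduces the four identities to intervals.\<close>
  have all_split: "(\<forall>i. P i) \<longleftrightarrow> P j \<and> (\<forall>i\<in>-{j}. P i)" for P
    by auto
  have 1: "cbox (h *\<^sub>R ?e) (1 + h *\<^sub>R ?e) \<inter> {x. x \<bullet> ?e \<le> 1} = cbox (h *\<^sub>R ?e) 1"
    unfolding set_eq_iff Int_iff mem_box_cart mem_Collect_eq inner all_split
    using h by (auto simp: ax)
  have 2: "cbox (h *\<^sub>R ?e) (1 + h *\<^sub>R ?e) \<inter> {x. 1 \<le> x \<bullet> ?e} = cbox ?e (1 + h *\<^sub>R ?e)"
    unfolding set_eq_iff Int_iff mem_box_cart mem_Collect_eq inner all_split
    using h by (auto simp: ax)
  \<comment> \<open>The corners are left in the form that a translation by \<open>?e\<close>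
    produces.\<close>
  have 3: "cbox 0 1 \<inter> {x. x \<bullet> ?e \<le> h} = cbox (?e - ?e) ((1 + h *\<^sub>R ?e) - ?e)"
    unfolding set_eq_iff Int_iff mem_box_cart mem_Collect_eq inner all_split
    using h by (auto simp: ax)
  have 4: "cbox 0 1 \<inter> {x. h \<le> x \<bullet> ?e} = cbox (h *\<^sub>R ?e) 1"
    unfolding set_eq_iff Int_iff mem_box_cart mem_Collect_eq inner all_split
    using h by (auto simp: ax)
  have "integral (cbox 0 1) (\<lambda>x. f (x + h *\<^sub>R ?e)) = integral (cbox (h *\<^sub>R ?e) (1 + h *\<^sub>R ?e)) f"
    using integral_shift_cbox[of "h *\<^sub>R ?e" "h *\<^sub>R ?e" "1 + h *\<^sub>R ?e" f] by simp
  also have "\<dots> = integral (cbox (h *\<^sub>R ?e) 1) f + integral (cbox ?e (1 + h *\<^sub>R ?e)) f"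
    using integral_split[OF int e, of "h *\<^sub>R ?e" "1 + h *\<^sub>R ?e" 1] unfolding 1 2 .
  also have "integral (cbox ?e (1 + h *\<^sub>R ?e)) f =
      integral (cbox (?e - ?e) ((1 + h *\<^sub>R ?e) - ?e)) (\<lambda>x. f (x + ?e))"
    by (rule integral_shift_cbox[symmetric])
  also have "(\<lambda>x. f (x + ?e)) = f"
    using per by (simp add: fun_eq_iff periodic_axis)
  also have "integral (cbox (h *\<^sub>R ?e) 1) f + integral (cbox (?e - ?e) ((1 + h *\<^sub>R ?e) - ?e)) f =
      integral (cbox 0 1) f"
    using integral_split[OF int e, of 0 1 h] unfolding 3 4 by simp
  finally show ?thesis .
qed

text \<open>The integral of a shifted periodic function does not depend on the shift, so its derivative in
  the shift is zero.\<close>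

lemma integral_torus_partial_derivative:
  fixes f :: "real^'n \<Rightarrow> real"
  assumes per: "periodic f" and der: "\<And>x. (f has_derivative f' x) (at x)"
    and cont: "continuous_on UNIV (\<lambda>x. f' x (axis j 1))"
  shows "(LINT x|torus. f' x (axis j 1)) = 0"
proof -
  let ?e = "axis j 1 :: real^'n"
  have contf: "continuous_on UNIV f"
    using der by (auto simp: continuous_on_eq_continuous_at intro: has_derivative_continuous)
  \<comment> \<open>Shift invariance is known only for \<open>h\<close> in \<open>{0..1}\<close>, so
    the derivative at 0 is taken one-sided; it is still unique on a nondegenerate interval.\<close>
  have "((\<lambda>h. integral (cbox 0 1) (\<lambda>x. f (x + h *\<^sub>R ?e))) has_vector_derivative
      integral (cbox 0 1) (\<lambda>x. f' (x + 0 *\<^sub>R ?e) ?e)) (at 0 within {0..1})"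
  proof (rule leibniz_rule_vector_derivative)
    fix h x
    have "((\<lambda>h. f (x + h *\<^sub>R ?e)) has_derivative (\<lambda>d. f' (x + h *\<^sub>R ?e) (d *\<^sub>R ?e))) (at h)"
      by (rule has_derivative_compose[OF _ der]) (auto intro!: derivative_eq_intros)
    moreover have "f' (x + h *\<^sub>R ?e) (d *\<^sub>R ?e) = d *\<^sub>R f' (x + h *\<^sub>R ?e) ?e" for d
      using has_derivative_bounded_linear[OF der] by (simp add: linear_simps)
    ultimately show "((\<lambda>h. f (x + h *\<^sub>R ?e)) has_vector_derivative f' (x + h *\<^sub>R ?e) ?e)
        (at h within {0..1})"
      by (auto simp: has_vector_derivative_def intro: has_derivative_at_withinI)
  next
    fix h show "(\<lambda>x. f (x + h *\<^sub>R ?e)) integrable_on cbox 0 1"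
      by (intro integrable_continuous continuous_on_compose2[OF contf] continuous_on_add
          continuous_on_id continuous_on_const) auto
  next
    show "continuous_on ({0..1} \<times> cbox 0 1) (\<lambda>(h, x). f' (x + h *\<^sub>R ?e) ?e)"
      unfolding split_beta
      by (intro continuous_on_compose2[OF cont] continuous_intros) auto
  qed auto
  then have "((\<lambda>h. integral (cbox 0 1) f) has_vector_derivative
      integral (cbox 0 1) (\<lambda>x. f' (x + 0 *\<^sub>R ?e) ?e)) (at 0 within {0..1})"
    by (rule has_vector_derivative_transform[rotated 2])
      (auto simp: integral_cube_shift[OF per contf])
  moreover have "((\<lambda>h. integral (cbox 0 1) f) has_vector_derivative 0) (at 0 within {0..1::real})"
    by simp
  ultimately have "integral (cbox 0 1) (\<lambda>x. f' (x + 0 *\<^sub>R ?e) ?e) = 0"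
    by (intro vector_derivative_unique_within_closed_interval[of 0 1 0]) auto
  then show ?thesis
    using cont by (subst integral_torus_continuous) (auto intro: continuous_on_subset)
qed

lemma divergence_eq_sum:
  assumes "(f has_derivative f') (at x)"
  shows "divergence f x = (\<Sum>j\<in>UNIV. f' (axis j 1) $ j)"
  using frechet_derivative_at[OF assms]
  by (simp add: divergence_def jacobian_def trace_def matrix_def)

text \<open>When div u = 0, the product rule gives div(\<open>\<phi> u\<close>) =
  \<open>u \<bullet> \<nabla>\<phi>\<close>, so the inner product is a sum of integrals of partial
  derivatives of periodic functions. This is what places \<open>\<beta> t\<close> in
  \<open>L2_div\<close>.\<close>

lemma divergence_free_L2_inner_grad:
  fixes u :: "real^'n \<Rightarrow> real^'n"
  assumes per: "periodic u" "periodic \<phi>" and C1: "Ck_on 1 UNIV u" "Ck_on 1 UNIV \<phi>"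
    and div: "\<And>x. divergence u x = 0"
  shows "L2_inner u (grad \<phi>) = 0"
proof -
  obtain u' where u': "\<And>x. (u has_derivative u' x) (at x)" "\<And>h. continuous_on UNIV (\<lambda>x. u' x h)"
    using C1(1) by auto
  obtain p' where p': "\<And>x. (\<phi> has_derivative p' x) (at x)" "\<And>h. continuous_on UNIV (\<lambda>x. p' x h)"
    using C1(2) by auto
  have cont: "continuous_on UNIV u" "continuous_on UNIV \<phi>"
    using C1 Ck_on_continuous by blast+
  define D where "D j x h = \<phi> x * u' x h $ j + p' x h * u x $ j" for j x h
  have D: "((\<lambda>x. \<phi> x * u x $ j) has_derivative D j x) (at x)" for j x
    unfolding D_def[abs_def]
    by (rule has_derivative_mult[OF p'(1)])
      (rule bounded_linear.has_derivative[OF bounded_linear_vec_nth u'(1)])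
  have contD: "continuous_on UNIV (\<lambda>x. D j x h)" for j h
    unfolding D_def by (intro continuous_intros u' p' cont)
  have D0: "(LINT x|torus. D j x (axis j 1)) = 0" for j
    by (rule integral_torus_partial_derivative[OF _ D contD]) (use per in \<open>auto simp: periodic_def\<close>)
  have eq: "u x \<bullet> grad \<phi> x = (\<Sum>j\<in>UNIV. D j x (axis j 1))" for x
  proof -
    have "(\<Sum>j\<in>UNIV. D j x (axis j 1)) =
        \<phi> x * (\<Sum>j\<in>UNIV. u' x (axis j 1) $ j) + (\<Sum>j\<in>UNIV. p' x (axis j 1) * u x $ j)"
      by (simp add: D_def sum.distrib sum_distrib_left)
    also have "(\<Sum>j\<in>UNIV. u' x (axis j 1) $ j) = 0"
      using div[of x] divergence_eq_sum[OF u'(1)] by simp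
    also have "(\<Sum>j\<in>UNIV. p' x (axis j 1) * u x $ j) = u x \<bullet> grad \<phi> x"
      by (simp add: grad_def inner_vec_def frechet_derivative_at[OF p'(1), symmetric] mult.commute)
    finally show ?thesis by simp
  qed
  have "L2_inner u (grad \<phi>) = (\<Sum>j\<in>UNIV. LINT x|torus. D j x (axis j 1))"
    unfolding L2_inner_def eq
    by (rule Bochner_Integration.integral_sum)
      (auto intro!: integral_torus_continuous(1) continuous_on_subset[OF contD])
  then show ?thesis by (simp add: D0)
qed

section \<open>Square-integrable fields\<close>

lemma bounded_bilinear_matrix_vector_mult:
  "bounded_bilinear (\<lambda>(A :: real^'n^'m) x. A *v x)"
  unfolding bilinear_conv_bounded_bilinear[symmetric] bilinear_def linear_iff
  by (simp add: matrix_vector_mult_add_rdistrib matrix_vector_right_distrib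
      scaleR_matrix_vector_assoc[symmetric] matrix_vector_mult_scaleR)

lemmas continuous_on_matrix_vector_mult =
  bounded_bilinear.continuous_on[OF bounded_bilinear_matrix_vector_mult]

lemma space_torus: "space torus = cbox 0 1"
  by (simp add: torus_def space_restrict_space)

lemma finite_measure_torus: "finite_measure torus"
  by standard
    (simp add: space_torus torus_def emeasure_restrict_space emeasure_lborel_cbox_eq)

lemma measurable_torus: "f \<in> borel_measurable borel \<Longrightarrow> f \<in> borel_measurable torus"
  by (simp add: torus_def measurable_restrict_space1)

text \<open>Unlike \<open>L2\<close>, this asks for no periodicity and permits any target dimension:
  products with matrix fields then stay in the class, and only the unit cube has to be looked
  at.\<close>

definition sq_int :: "(real^'n \<Rightarrow> real^'m) \<Rightarrow> bool" where
  "sq_int f \<longleftrightarrow> f \<in> borel_measurable torus \<and> integrable torus (\<lambda>x. (norm (f x))\<^sup>2)"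

lemma sq_int_L2: "f \<in> L2 \<Longrightarrow> sq_int f"
  by (simp add: L2_def sq_int_def measurable_torus)

lemma sq_int_L2_div: "f \<in> L2_div \<Longrightarrow> sq_int f"
  by (simp add: L2_div_def sq_int_L2)

lemma sq_int_inner:
  assumes "sq_int f" "sq_int g"
  shows "integrable torus (\<lambda>x. f x \<bullet> g x)"
proof (rule Bochner_Integration.integrable_bound)
  show "integrable torus (\<lambda>x. (norm (f x))\<^sup>2 + (norm (g x))\<^sup>2)"
    using assms by (simp add: sq_int_def)
  show "(\<lambda>x. f x \<bullet> g x) \<in> borel_measurable torus"
    using assms by (auto simp: sq_int_def intro: borel_measurable_inner)
  have "\<bar>f x \<bullet> g x\<bar> \<le> (norm (f x))\<^sup>2 + (norm (g x))\<^sup>2" for x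
  proof -
    have "2 * (norm (f x) * norm (g x)) \<le> (norm (f x))\<^sup>2 + (norm (g x))\<^sup>2"
      using sum_squares_bound[of "norm (f x)" "norm (g x)"] by simp
    moreover have "0 \<le> norm (f x) * norm (g x)" by simp
    ultimately show ?thesis using Cauchy_Schwarz_ineq2[of "f x" "g x"] by linarith
  qed
  then show "AE x in torus. norm (f x \<bullet> g x) \<le> norm ((norm (f x))\<^sup>2 + (norm (g x))\<^sup>2)"
    by (intro AE_I2) simp
qed

lemma sq_int_bound:
  assumes "sq_int f" "g \<in> borel_measurable torus" "\<And>x. x \<in> cbox 0 1 \<Longrightarrow> norm (g x) \<le> K * norm (f x)"
  shows "sq_int g"
proof -
  have "integrable torus (\<lambda>x. (norm (g x))\<^sup>2)"
  proof (rule Bochner_Integration.integrable_bound)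
    show "integrable torus (\<lambda>x. K\<^sup>2 * (norm (f x))\<^sup>2)"
      using assms(1) by (simp add: sq_int_def)
    show "(\<lambda>x. (norm (g x))\<^sup>2) \<in> borel_measurable torus" using assms(2) by simp
    show "AE x in torus. norm ((norm (g x))\<^sup>2) \<le> norm (K\<^sup>2 * (norm (f x))\<^sup>2)"
      using power_mono[OF assms(3), of _ 2]
      by (intro AE_I2) (auto simp: space_torus power_mult_distrib)
  qed
  with assms(2) show ?thesis by (simp add: sq_int_def)
qed

lemma sq_int_continuous:
  assumes "continuous_on UNIV f"
  shows "sq_int f"
  unfolding sq_int_def
  by (intro conjI measurable_torus borel_measurable_continuous_onI assms
      integral_torus_continuous(1) continuous_intros continuous_on_subset[OF assms]) simp

lemma sq_int_add:
  assumes "sq_int f" "sq_int g"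
  shows "sq_int (\<lambda>x. f x + g x)"
proof -
  have "integrable torus (\<lambda>x. f x \<bullet> f x + 2 * (f x \<bullet> g x) + g x \<bullet> g x)"
    by (intro Bochner_Integration.integrable_add integrable_mult_right sq_int_inner assms)
  moreover have "(\<lambda>x. f x + g x) \<in> borel_measurable torus"
    using assms by (auto simp: sq_int_def intro: borel_measurable_add)
  ultimately show ?thesis
    by (simp add: sq_int_def power2_norm_eq_inner inner_add_left inner_add_right inner_commute algebra_simps)
qed

lemma sq_int_scaleR: "sq_int f \<Longrightarrow> sq_int (\<lambda>x. c *\<^sub>R f x)"
  by (auto simp: sq_int_def power_mult_distrib intro: borel_measurable_scaleR)

lemma sq_int_diff:
  assumes "sq_int f" "sq_int g"
  shows "sq_int (\<lambda>x. f x - g x)"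
  using sq_int_add[OF assms(1) sq_int_scaleR[OF assms(2), of "-1"]] by simp

lemma sq_int_matrix:
  fixes M :: "real^'n \<Rightarrow> real^'k^'m"
  assumes M: "continuous_on UNIV M" and f: "sq_int f"
  shows "sq_int (\<lambda>x. M x *v f x)"
proof -
  obtain K where K: "\<And>(A::real^'k^'m) x. norm (A *v x) \<le> norm A * norm x * K" "0 < K"
    using bounded_bilinear.pos_bounded[OF bounded_bilinear_matrix_vector_mult] by blast
  have "compact (M ` cbox 0 1)"
    by (rule compact_continuous_image[OF continuous_on_subset[OF M subset_UNIV] compact_cbox])
  then have "\<exists>B. \<forall>x\<in>cbox 0 1. norm (M x) \<le> B"
    by (auto dest!: compact_imp_bounded simp: bounded_iff)
  then obtain B where B: "\<And>x. x \<in> cbox 0 1 \<Longrightarrow> norm (M x) \<le> B" by blast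
  show ?thesis
  proof (rule sq_int_bound[OF f])
    show "(\<lambda>x. M x *v f x) \<in> borel_measurable torus"
    proof (rule borel_measurable_continuous_Pair[where H="\<lambda>A x. A *v x"])
      show "M \<in> borel_measurable torus"
        by (intro measurable_torus borel_measurable_continuous_onI M)
      show "continuous_on UNIV (\<lambda>x :: (real^'k^'m) \<times> (real^'k). fst x *v snd x)"
        by (rule continuous_on_matrix_vector_mult[OF continuous_on_fst[OF continuous_on_id]
            continuous_on_snd[OF continuous_on_id]])
      show "f \<in> borel_measurable torus" using f by (simp add: sq_int_def)
    qed
    fix x :: "real^'n" assume "x \<in> cbox 0 1"
    then have "norm (M x) * norm (f x) * K \<le> B * norm (f x) * K"
      using B K(2) by (intro mult_right_mono) auto
    with K(1)[of "M x" "f x"] have "norm (M x *v f x) \<le> B * norm (f x) * K" by linarith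
    then show "norm (M x *v f x) \<le> (B * K) * norm (f x)" by (simp only: mult_ac)
  qed
qed

lemma L2_norm_sq: "(L2_norm f)\<^sup>2 = (LINT x|torus. f x \<bullet> f x)"
  by (simp add: L2_norm_def power2_norm_eq_inner Bochner_Integration.integral_nonneg)

lemma L2_norm_nonneg: "0 \<le> L2_norm f"
  by (simp add: L2_norm_def)

text \<open>The discriminant argument for the nonnegative polynomial
  \<open>\<parallel>f + s g\<parallel>\<^sup>2\<close> in \<open>s\<close>.\<close>

lemma L2_inner_Cauchy_Schwarz:
  assumes "sq_int f" "sq_int g"
  shows "\<bar>L2_inner f g\<bar> \<le> L2_norm f * L2_norm g"
proof -
  let ?a = "(L2_norm f)\<^sup>2" and ?b = "(L2_norm g)\<^sup>2" and ?c = "L2_inner f g"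
  have "0 \<le> ?b * s\<^sup>2 + 2 * ?c * s + ?a" for s
  proof -
    have "0 \<le> (LINT x|torus. (f x + s *\<^sub>R g x) \<bullet> (f x + s *\<^sub>R g x))"
      by (rule Bochner_Integration.integral_nonneg) simp
    also have "\<dots> = (LINT x|torus. f x \<bullet> f x + (2 * s) * (f x \<bullet> g x) + s\<^sup>2 * (g x \<bullet> g x))"
      by (rule Bochner_Integration.integral_cong)
        (auto simp: inner_add_left inner_add_right inner_commute power2_eq_square algebra_simps)
    also have "\<dots> = ?a + (2 * s) * ?c + s\<^sup>2 * ?b"
      using assms by (simp add: L2_norm_sq L2_inner_def sq_int_inner)
    finally show ?thesis by (simp add: algebra_simps)
  qed
  note q = this
  have "?c\<^sup>2 \<le> ?a * ?b"
  proof (cases "?b = 0")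
    case True
    have "?c = 0"
    proof (rule ccontr)
      assume "?c \<noteq> 0"
      \<comment> \<open>With zero leading coefficient the polynomial is affine, and at this
        \<open>s\<close> it would equal -1.\<close>
      then have "2 * ?c * (- (?a + 1) / (2 * ?c)) = - (?a + 1)" by simp
      with q[of "- (?a + 1) / (2 * ?c)"] True show False by simp
    qed
    then show ?thesis by simp
  next
    case False
    then have b: "0 < ?b" by (simp add: less_le)
    have "0 \<le> ?b * (- ?c / ?b)\<^sup>2 + 2 * ?c * (- ?c / ?b) + ?a" by (rule q)
    also have "\<dots> = ?a - ?c\<^sup>2 / ?b" using False by (simp add: field_simps power2_eq_square)
    finally show ?thesis using b by (simp add: field_simps)
  qed
  then have "?c\<^sup>2 \<le> (L2_norm f * L2_norm g)\<^sup>2" by (simp add: power_mult_distrib)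
  then show ?thesis by (rule abs_le_square_iff[THEN iffD2, THEN order_trans]) (simp add: L2_norm_nonneg)
qed

section \<open>Smooth fields on a time slab\<close>

lemma jacobian_has_derivative:
  fixes f :: "real^'n \<Rightarrow> real^'m"
  assumes "(f has_derivative f') (at x)"
  shows "jacobian f (at x) = matrix f'" "(f has_derivative (\<lambda>h. jacobian f (at x) *v h)) (at x)"
  using frechet_derivative_at[OF assms] jacobian_works[of f "at x"] assms
  by (auto simp: jacobian_def differentiable_def)

text \<open>The slab derivative is restricted to \<open>{t} \<times> UNIV\<close> and to
  \<open>{0..T} \<times> {x}\<close>. The first set is a full copy of space, so the spatial
  derivative is unrestricted even at \<open>t = 0\<close> and \<open>t = T\<close>; the time
  derivative is one-sided there.\<close>

lemma smooth_slab_derivatives: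
  fixes u :: "real \<Rightarrow> real^'n \<Rightarrow> real^'m"
  assumes smooth: "smooth_on ({0..T} \<times> UNIV) (\<lambda>(t, x). u t x)"
  shows "\<And>t x. t \<in> {0..T} \<Longrightarrow> (u t has_derivative (\<lambda>h. jacobian (u t) (at x) *v h)) (at x)"
    and "\<And>t x. t \<in> {0..T} \<Longrightarrow> (\<lambda>s. u s x) differentiable (at t within {0..T})"
    and "continuous_on ({0..T} \<times> UNIV) (\<lambda>(t, x). jacobian (u t) (at x))"
proof -
  let ?S = "{0..T} \<times> (UNIV :: (real^'n) set)"
  have "Ck_on (Suc 0) ?S (\<lambda>(t, x). u t x)" using smooth unfolding smooth_on_def by blast
  then obtain f' where f': "\<forall>p\<in>?S. ((\<lambda>(t, x). u t x) has_derivative f' p) (at p within ?S)"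
    "\<forall>h. continuous_on ?S (\<lambda>p. f' p h)"
    by auto
  have d: "(u t has_derivative (\<lambda>h. f' (t, x) (0, h))) (at x)" if t: "t \<in> {0..T}" for t x
  proof -
    have "((\<lambda>x. (case (t, x) of (t, x) \<Rightarrow> u t x)) has_derivative (\<lambda>h. f' (t, x) (0, h))) (at x within UNIV)"
      by (rule has_derivative_in_compose2[where t="?S" and g="\<lambda>(t, x). u t x" and f="Pair t",
            OF f'(1)[rule_format] _ _ has_derivative_Pair[OF has_derivative_const has_derivative_ident]])
        (use t in auto)
    then show ?thesis by simp
  qed
  show "(u t has_derivative (\<lambda>h. jacobian (u t) (at x) *v h)) (at x)" if "t \<in> {0..T}" for t x
    by (rule jacobian_has_derivative(2)[OF d[OF that]])
  show "(\<lambda>s. u s x) differentiable (at t within {0..T})" if t: "t \<in> {0..T}" for t x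
  proof -
    have "((\<lambda>s. (case (s, x) of (t, x) \<Rightarrow> u t x)) has_derivative (\<lambda>h. f' (t, x) (h, 0))) (at t within {0..T})"
      by (rule has_derivative_in_compose2[where t="?S" and g="\<lambda>(t, x). u t x" and f="\<lambda>s. (s, x)",
            OF f'(1)[rule_format] _ _ has_derivative_Pair[OF has_derivative_ident has_derivative_const]])
        (use t in auto)
    then show ?thesis by (auto simp: differentiable_def)
  qed
  have "continuous_on ?S (\<lambda>p. \<chi> i j. f' p (0, axis j 1) $ i)"
    by (intro continuous_intros f'(2)[rule_format])
  then show "continuous_on ?S (\<lambda>(t, x). jacobian (u t) (at x))"
    by (rule continuous_on_eq) (auto simp: jacobian_has_derivative(1)[OF d] matrix_def)
qed

lemma smooth_slab_slice:
  assumes "smooth_on (I \<times> UNIV) (\<lambda>(t, x). u t x)" "t \<in> I"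
  shows "Ck_on k UNIV (u t)"
  using assms by (auto simp: smooth_on_def intro: Ck_on_slice)

lemma slab_slice_continuous:
  assumes "continuous_on (I \<times> UNIV) (\<lambda>(t, x). u t x)" "t \<in> I"
  shows "continuous_on UNIV (u t)"
proof -
  have "continuous_on UNIV (\<lambda>x. (\<lambda>(t, x). u t x) (t, x))"
    by (rule continuous_on_compose2[OF assms(1)]) (use assms(2) in \<open>auto intro!: continuous_intros\<close>)
  then show ?thesis by simp
qed

lemma periodic_jacobian:
  fixes f :: "real^'n \<Rightarrow> real^'m"
  assumes "periodic f" and d: "\<And>x. (f has_derivative (\<lambda>h. jacobian f (at x) *v h)) (at x)"
  shows "periodic (\<lambda>x. jacobian f (at x))"
  unfolding periodic_def
proof (intro allI impI)
  fix x k :: "real^'n" assume k: "\<forall>i. k $ i \<in> \<int>"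
  have "((\<lambda>y. f (y + k)) has_derivative (\<lambda>h. jacobian f (at (x + k)) *v h)) (at x)"
    by (rule has_derivative_compose[OF _ d]) (auto intro!: derivative_eq_intros)
  moreover have "(\<lambda>y. f (y + k)) = f"
    using assms(1) k by (auto simp: periodic_def)
  ultimately have "(f has_derivative (\<lambda>h. jacobian f (at (x + k)) *v h)) (at x)" by simp
  from jacobian_has_derivative(1)[OF this] show "jacobian f (at (x + k)) = jacobian f (at x)"
    by simp
qed

lemma periodic_reduce:
  fixes f :: "real^'n \<Rightarrow> 'b"
  assumes "periodic f"
  obtains y where "y \<in> cbox 0 1" "f x = f y"
proof -
  define k :: "real^'n" where "k = (\<chi> i. - of_int \<lfloor>x $ i\<rfloor>)"
  have "f (x + k) = f x" using assms by (auto simp: periodic_def k_def)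
  moreover have "x + k \<in> cbox 0 1"
    by (auto simp: mem_box_cart k_def) linarith+
  ultimately show thesis using that by metis
qed

lemma periodic_slab_bounded:
  fixes F :: "real \<Rightarrow> real^'n \<Rightarrow> 'b::real_normed_vector"
  assumes "continuous_on ({0..T} \<times> UNIV) (\<lambda>(t, x). F t x)" "\<And>t. t \<in> {0..T} \<Longrightarrow> periodic (F t)"
  obtains K where "0 \<le> K" "\<And>t x. t \<in> {0..T} \<Longrightarrow> norm (F t x) \<le> K"
proof -
  have "compact ((\<lambda>(t, x). F t x) ` ({0..T} \<times> cbox 0 1))"
    by (intro compact_continuous_image compact_Times continuous_on_subset[OF assms(1)]) auto
  then have "\<exists>K. \<forall>p\<in>{0..T} \<times> cbox 0 1. norm ((\<lambda>(t, x). F t x) p) \<le> K"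
    using compact_imp_bounded by (force simp: bounded_iff)
  then obtain K where "\<forall>p\<in>{0..T} \<times> cbox 0 1. norm ((\<lambda>(t, x). F t x) p) \<le> K" by blast
  then have K: "norm (F t x) \<le> K" if "t \<in> {0..T}" "x \<in> cbox 0 1" for t x
    using that by auto
  have "norm (F t x) \<le> max K 0" if t: "t \<in> {0..T}" for t x
  proof -
    obtain y where "y \<in> cbox 0 1" "F t x = F t y" using periodic_reduce[OF assms(2)[OF t]] by blast
    then show ?thesis using K[OF t, of y] by simp
  qed
  then show thesis by (intro that[of "max K 0"]) auto
qed

text \<open>Periodicity and compactness bound the Jacobian uniformly. Applied to
  \<open>\<beta>\<close> and \<open>\<omega>\<close>, this shows that the set in
  \<open>spatial_lipschitz_constant\<close> is nonempty, so that its infimum is meaningful.\<close>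

lemma smooth_periodic_lipschitz:
  fixes u :: "real \<Rightarrow> real^'n \<Rightarrow> real^'m"
  assumes smooth: "smooth_on ({0..T} \<times> UNIV) (\<lambda>(t, x). u t x)"
    and per: "\<And>t. t \<in> {0..T} \<Longrightarrow> periodic (u t)"
  obtains L where "\<And>t. t \<in> {0..T} \<Longrightarrow> L-lipschitz_on UNIV (u t)"
proof -
  note d = smooth_slab_derivatives[OF smooth]
  have "\<And>t. t \<in> {0..T} \<Longrightarrow> periodic (\<lambda>x. jacobian (u t) (at x))"
    by (intro periodic_jacobian per d(1))
  from periodic_slab_bounded[OF d(3) this] obtain K
    where K: "0 \<le> K" "\<And>t x. t \<in> {0..T} \<Longrightarrow> norm (jacobian (u t) (at x)) \<le> K"
    by blast
  obtain M where M: "\<And>(A::real^'n^'m) x. norm (A *v x) \<le> norm A * norm x * M" "0 < M"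
    using bounded_bilinear.pos_bounded[OF bounded_bilinear_matrix_vector_mult] by blast
  have "(K * M)-lipschitz_on UNIV (u t)" if t: "t \<in> {0..T}" for t
  proof (rule bounded_derivative_imp_lipschitz[where f'="\<lambda>x h. jacobian (u t) (at x) *v h"])
    fix x show "onorm ((*v) (jacobian (u t) (at x))) \<le> K * M"
    proof (rule onorm_le)
      fix h :: "real^'n"
      have "norm (jacobian (u t) (at x)) * norm h * M \<le> K * norm h * M"
        using K(2)[OF t] M(2) by (intro mult_right_mono) auto
      with M(1)[of "jacobian (u t) (at x)" h]
      have "norm (jacobian (u t) (at x) *v h) \<le> K * norm h * M" by linarith
      then show "norm (jacobian (u t) (at x) *v h) \<le> (K * M) * norm h" by (simp only: mult_ac)
    qed
  qed (use d(1)[OF t] K M in auto)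
  then show thesis by (rule that)
qed

text \<open>For every nonzero \<open>s\<close> the remainder quotient along \<open>x + s h\<close>
  is at least \<open>norm (f' h) - L * norm h\<close>, and it tends to 0.\<close>

lemma lipschitz_derivative_bound:
  fixes f :: "'a::real_normed_vector \<Rightarrow> 'b::real_normed_vector"
  assumes lip: "L-lipschitz_on UNIV f" and der: "(f has_derivative f') (at x)"
  shows "norm (f' h) \<le> L * norm h"
proof -
  have "((\<lambda>s. f (x + s *\<^sub>R h)) has_derivative (\<lambda>s. f' (s *\<^sub>R h))) (at 0)"
    by (rule has_derivative_compose[of "\<lambda>s. x + s *\<^sub>R h"]) (use der in \<open>auto intro!: derivative_eq_intros\<close>)
  then have lim: "((\<lambda>s. norm (f (x + s *\<^sub>R h) - f x - s *\<^sub>R f' h) / \<bar>s\<bar>) \<longlongrightarrow> 0) (at 0)"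
    using linear_scale[OF has_derivative_linear[OF der]] by (simp add: has_derivative_iff_norm)
  have "norm (f' h) - L * norm h \<le> 0"
  proof (rule tendsto_lowerbound[OF lim])
    show "\<forall>\<^sub>F s in at 0. norm (f' h) - L * norm h \<le> norm (f (x + s *\<^sub>R h) - f x - s *\<^sub>R f' h) / \<bar>s\<bar>"
    proof (rule eventually_at_filter[THEN iffD2], rule always_eventually, intro allI impI)
      fix s :: real assume s: "s \<noteq> 0"
      have "norm (f (x + s *\<^sub>R h) - f x) \<le> L * norm (s *\<^sub>R h)"
        using lipschitz_onD[OF lip, of "x + s *\<^sub>R h" x] by (simp add: dist_norm)
      moreover have "norm (s *\<^sub>R f' h) \<le>
          norm (f (x + s *\<^sub>R h) - f x) + norm (f (x + s *\<^sub>R h) - f x - s *\<^sub>R f' h)"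
        using norm_triangle_ineq4[of "f (x + s *\<^sub>R h) - f x" "f (x + s *\<^sub>R h) - f x - s *\<^sub>R f' h"]
        by simp
      ultimately have "\<bar>s\<bar> * (norm (f' h) - L * norm h) \<le>
          norm (f (x + s *\<^sub>R h) - f x - s *\<^sub>R f' h)"
        by (simp add: algebra_simps)
      then show "norm (f' h) - L * norm h \<le> norm (f (x + s *\<^sub>R h) - f x - s *\<^sub>R f' h) / \<bar>s\<bar>"
        using s by (simp add: field_simps)
    qed
  qed simp
  then show ?thesis by simp
qed

text \<open>The infimum is attained: for two fixed distinct points every admissible constant bounds
  the same difference quotient, and hence so does the infimum of these constants.\<close>

lemma spatial_lipschitz_constant_lipschitz:
  fixes \<omega> :: "real \<Rightarrow> real^'n \<Rightarrow> real^'n"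
  assumes T: "0 \<le> T" and "smooth_on ({0..T} \<times> UNIV) (\<lambda>(t, x). \<beta> t x)"
    "smooth_on ({0..T} \<times> UNIV) (\<lambda>(t, x). \<omega> t x)"
    and "\<And>t. t \<in> {0..T} \<Longrightarrow> periodic (\<beta> t) \<and> periodic (\<omega> t)" and t: "t \<in> {0..T}"
  shows "(spatial_lipschitz_constant T \<beta> \<omega>)-lipschitz_on UNIV (\<lambda>x. (\<beta> t x, \<omega> t x))"
proof -
  let ?A = "{L. \<forall>t\<in>{0..T}. L-lipschitz_on UNIV (\<lambda>x. (\<beta> t x, \<omega> t x))}"
  let ?L = "spatial_lipschitz_constant T \<beta> \<omega>"
  obtain L1 where L1: "\<And>t. t \<in> {0..T} \<Longrightarrow> L1-lipschitz_on UNIV (\<beta> t)"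
    using smooth_periodic_lipschitz[OF assms(2)] assms(4) by blast
  obtain L2 where L2: "\<And>t. t \<in> {0..T} \<Longrightarrow> L2-lipschitz_on UNIV (\<omega> t)"
    using smooth_periodic_lipschitz[OF assms(3)] assms(4) by blast
  have "sqrt (L1\<^sup>2 + L2\<^sup>2) \<in> ?A"
    by (intro CollectI ballI lipschitz_on_Pair L1 L2)
  then have ne: "?A \<noteq> {}" by blast
  have L: "?L = Inf ?A" by (simp add: spatial_lipschitz_constant_def)
  have nonneg: "0 \<le> l" if "l \<in> ?A" for l
    using that t lipschitz_on_nonneg by blast
  show ?thesis
  proof (rule lipschitz_onI)
    fix x y :: "real^'n"
    let ?d = "dist (\<beta> t x, \<omega> t x) (\<beta> t y, \<omega> t y)"
    show "?d \<le> ?L * dist x y"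
    proof (cases "x = y")
      case False
      have "?d / dist x y \<le> l" if "l \<in> ?A" for l
      proof -
        have "l-lipschitz_on UNIV (\<lambda>x. (\<beta> t x, \<omega> t x))" using that t by blast
        from lipschitz_onD[OF this UNIV_I UNIV_I] show ?thesis
          using False by (simp only: divide_le_eq zero_less_dist_iff if_True simp_thms)
      qed
      with ne have "?d / dist x y \<le> ?L" unfolding L by (rule cInf_greatest)
      then show ?thesis using False by (simp add: divide_le_eq)
    qed simp
  next
    show "0 \<le> ?L" unfolding L by (rule cInf_greatest[OF ne nonneg])
  qed
qed

section \<open>Measurability on a time slab\<close>

text \<open>\<open>spacetime_measurable\<close> with values in any Euclidean space, as matrix fields
  and scalar integrands occur too.\<close>

definition slab_meas :: "real \<Rightarrow> (real \<Rightarrow> real^'n \<Rightarrow> 'b::euclidean_space) \<Rightarrow> bool" where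
  "slab_meas T F \<longleftrightarrow> set_borel_measurable borel ({0..T} \<times> UNIV) (\<lambda>(t, x). F t x)"

lemma slab_meas_continuous:
  assumes "continuous_on ({0..T} \<times> UNIV) (\<lambda>(t, x). F t x)"
  shows "slab_meas T F"
  unfolding slab_meas_def set_borel_measurable_def
  by (intro borel_measurable_continuous_on_indicator assms borel_closed closed_Times) auto

lemma slab_meas_bilinear:
  fixes F :: "real \<Rightarrow> real^'n \<Rightarrow> 'b::euclidean_space" and G :: "real \<Rightarrow> real^'n \<Rightarrow> 'c::euclidean_space"
  assumes pr: "bounded_bilinear pr" and F: "slab_meas T F" and G: "slab_meas T G"
  shows "slab_meas T (\<lambda>t x. pr (F t x) (G t x))"
proof -
  let ?i = "indicator ({0..T} \<times> UNIV) :: real \<times> (real^'n) \<Rightarrow> real"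
  have "(\<lambda>p. pr (?i p *\<^sub>R (case p of (t, x) \<Rightarrow> F t x)) (?i p *\<^sub>R (case p of (t, x) \<Rightarrow> G t x))) \<in> borel_measurable borel"
  proof (rule borel_measurable_continuous_Pair[where H=pr])
    show "continuous_on UNIV (\<lambda>x. pr (fst x) (snd x))"
      by (rule bounded_bilinear.continuous_on[OF pr continuous_on_fst[OF continuous_on_id]
            continuous_on_snd[OF continuous_on_id]])
  qed (use F G in \<open>simp_all only: slab_meas_def set_borel_measurable_def\<close>)
  \<comment> \<open>Off the slab both factors are extended by zero and \<open>pr\<close> maps zeros
    to zero, so the product of the extensions is the extension of the product.\<close>
  moreover have "(\<lambda>p. pr (?i p *\<^sub>R (case p of (t, x) \<Rightarrow> F t x)) (?i p *\<^sub>R (case p of (t, x) \<Rightarrow> G t x))) =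
      (\<lambda>p. ?i p *\<^sub>R (case p of (t, x) \<Rightarrow> pr (F t x) (G t x)))"
    by (auto simp: fun_eq_iff indicator_def bounded_bilinear.zero_left[OF pr])
  ultimately show ?thesis by (simp add: slab_meas_def set_borel_measurable_def)
qed

lemma slab_meas_add:
  assumes "slab_meas T F" "slab_meas T G"
  shows "slab_meas T (\<lambda>t x. F t x + G t x)"
proof -
  have "(\<lambda>p. indicator ({0..T} \<times> UNIV) p *\<^sub>R (case p of (t, x) \<Rightarrow> F t x) +
      indicator ({0..T} \<times> UNIV) p *\<^sub>R (case p of (t, x) \<Rightarrow> G t x)) \<in> borel_measurable borel"
    using assms unfolding slab_meas_def set_borel_measurable_def by (rule borel_measurable_add)
  then show ?thesis
    by (simp add: slab_meas_def set_borel_measurable_def split_beta scaleR_add_right)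
qed

lemma slab_meas_const: "slab_meas T (\<lambda>t x. c)"
  by (rule slab_meas_continuous) (simp add: split_beta)

lemma slab_meas_diff:
  assumes "slab_meas T F" "slab_meas T G"
  shows "slab_meas T (\<lambda>t x. F t x - G t x)"
  using slab_meas_add[OF assms(1)
      slab_meas_bilinear[OF bounded_bilinear_scaleR slab_meas_const[of T "-1"] assms(2)]]
  by simp

text \<open>Measurability of a parameter integral on the product space. It covers every measurable
  \<open>F\<close>: a slice that is not integrable has integral 0 by convention.\<close>

lemma slab_meas_integral:
  fixes F :: "real \<Rightarrow> real^'n \<Rightarrow> real"
  assumes F: "slab_meas T F"
  shows "set_borel_measurable lborel {0..T} (\<lambda>t. LINT x|torus. F t x)"
proof -
  interpret finite_measure "torus :: (real^'n) measure" by (rule finite_measure_torus)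
  let ?F = "\<lambda>p :: real \<times> (real^'n). indicator ({0..T} \<times> UNIV) p *\<^sub>R (case p of (t, x) \<Rightarrow> F t x)"
  have meas: "?F \<in> borel_measurable (borel \<Otimes>\<^sub>M borel)"
    using F by (simp add: slab_meas_def set_borel_measurable_def borel_prod)
  have "(\<lambda>p. (fst p, snd p)) \<in> (borel :: real measure) \<Otimes>\<^sub>M (torus :: (real^'n) measure) \<rightarrow>\<^sub>M borel \<Otimes>\<^sub>M borel"
    by (intro measurable_Pair measurable_fst measurable_compose[OF measurable_snd] measurable_torus) auto
  from measurable_compose[OF this meas]
  have "(\<lambda>(t, x). ?F (t, x)) \<in> borel_measurable (borel \<Otimes>\<^sub>M torus)"
    by (simp add: split_beta')
  from borel_measurable_lebesgue_integral[OF this]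
  have "(\<lambda>t. LINT x|torus. ?F (t, x)) \<in> borel_measurable borel" .
  moreover have "(LINT x|torus. ?F (t, x)) = indicator {0..T} t *\<^sub>R (LINT x|torus. F t x)" for t
    by (simp add: indicator_times)
  ultimately show ?thesis by (simp add: set_borel_measurable_def)
qed

section \<open>The relative energy\<close>

lemma outer_inner: "outer u v \<bullet> A = u \<bullet> (A *v v)"
  by (simp add: outer_def inner_vec_def matrix_vector_mult_def sum_distrib_left mult_ac)

lemma inner_transpose_self: "u \<bullet> (transpose A *v u) = u \<bullet> (A *v (u :: real^'n))"
  by (simp add: transpose_matrix_vector dot_lmul_matrix[symmetric] inner_commute)

text \<open>In the application \<open>A\<close> and \<open>M\<close> are the Jacobians of \<open>\<beta>\<close> and \<open>\<omega>\<close>. Then all terms on the right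
  except those of its first line integrate to zero.\<close>

lemma relative_energy_identity:
  fixes A M :: "real^'n^'n" and B v \<beta> \<omega> :: "real^'n"
  defines "w \<equiv> v - \<omega>" and "b \<equiv> B - \<beta>"
  shows "v \<bullet> v + (- 2 * (B \<bullet> (M *v B)) + r * (B \<bullet> B) - \<omega> \<bullet> \<omega>)
      + 2 * (B \<bullet> (M *v \<beta> - A *v \<omega>) + B \<bullet> (A *v v) - v \<bullet> (A *v B))
      - 2 * (\<beta> \<bullet> (M *v \<beta> - A *v \<omega>)) - 2 * r * (B \<bullet> \<beta>) + r * (\<beta> \<bullet> \<beta>) =
    (w \<bullet> w + r * (b \<bullet> b) - 2 * (b \<bullet> (M *v b)) - 2 * (w \<bullet> (A *v b)) + 2 * (b \<bullet> (A *v w)))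
      - 2 * (\<omega> \<bullet> (A *v B) + \<beta> \<bullet> (M *v B)) + 2 * (\<beta> \<bullet> (A *v w))
      - 2 * (w \<bullet> (A *v \<beta> - \<omega>)) + 2 * (\<beta> \<bullet> (A *v \<omega>))"
  unfolding w_def b_def
  by (simp add: inner_diff_left inner_diff_right matrix_vector_mult_diff_distrib
      inner_commute[of \<omega> v] inner_commute[of \<beta> B] algebra_simps)

lemma relative_energy_lower_bound:
  fixes A M :: "real^'n^'n" and w b :: "real^'n"
  assumes L: "0 \<le> L" and A: "\<And>h. norm (A *v h) \<le> L * norm h" and M: "\<And>h. norm (M *v h) \<le> L * norm h"
  shows "(w \<bullet> w) / 2 \<le> w \<bullet> w + (2 * L + 8 * L\<^sup>2) * (b \<bullet> b) - 2 * (b \<bullet> (M *v b)) - 2 * (w \<bullet> (A *v b)) + 2 * (b \<bullet> (A *v w))"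
proof -
  have CS: "\<bar>x \<bullet> (N *v y)\<bar> \<le> L * (norm x * norm y)"
    if "\<And>h. norm (N *v h) \<le> L * norm h" for N :: "real^'n^'n" and x y
    using Cauchy_Schwarz_ineq2[of x "N *v y"] mult_left_mono[OF that[of y], of "norm x"]
    by (simp add: mult_ac)
  \<comment> \<open>Young's inequality, weighted so that exactly half of
    \<open>(norm w)\<^sup>2\<close> is left over; this is the origin of
    \<open>8 * L\<^sup>2\<close>.\<close>
  have "(norm w - 4 * L * norm b)\<^sup>2 \<ge> 0" by simp
  then have "4 * L * (norm b * norm w) \<le> (norm w)\<^sup>2 / 2 + 8 * L\<^sup>2 * (norm b)\<^sup>2"
    by (simp add: power2_eq_square algebra_simps)
  then show ?thesis
    using CS[OF M, of b b] CS[OF A, of w b] CS[OF A, of b w]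
    by (simp add: power2_norm_eq_inner[symmetric] power2_eq_square algebra_simps abs_le_iff)
qed

section \<open>Slab integrals and consequences of the divergence constraint\<close>

lemma slab_integral_continuous:
  fixes F :: "real \<Rightarrow> real^'n \<Rightarrow> real"
  assumes "continuous_on ({0..T} \<times> UNIV) (\<lambda>(t, x). F t x)"
  shows "continuous_on {0..T} (\<lambda>t. LINT x|torus. F t x)"
proof -
  have "continuous_on {0..T} (\<lambda>t. integral (cbox 0 1) (F t))"
    by (rule integral_continuous_on_param) (rule continuous_on_subset[OF assms], auto)
  then show ?thesis
    by (rule continuous_on_eq)
      (rule integral_torus_continuous(2)[symmetric],
        rule continuous_on_subset[OF slab_slice_continuous[OF assms]], auto)
qed

lemma slab_integral_integrable:
  fixes F :: "real \<Rightarrow> real^'n \<Rightarrow> real"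
  assumes "slab_meas T F" "set_integrable lborel {0..T} g"
    and "AE t in lborel. t \<in> {0..T} \<longrightarrow> \<bar>LINT x|torus. F t x\<bar> \<le> g t"
  shows "set_integrable lborel {0..T} (\<lambda>t. LINT x|torus. F t x)"
proof (rule set_integrable_bound[OF assms(2) slab_meas_integral[OF assms(1)]])
  show "AE t in lborel. t \<in> {0..T} \<longrightarrow> norm (LINT x|torus. F t x) \<le> norm (g t)"
    using assms(3) by eventually_elim auto
qed

lemma inner_grad:
  assumes "(\<phi> has_derivative \<phi>') (at x)"
  shows "u \<bullet> grad \<phi> x = \<phi>' u"
proof -
  have "\<phi>' u = \<phi>' (\<Sum>i\<in>UNIV. u $ i *\<^sub>R axis i 1)"
    using basis_expansion[of u] by (simp add: scalar_mult_eq_scaleR)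
  also have "\<dots> = (\<Sum>i\<in>UNIV. u $ i * \<phi>' (axis i 1))"
    by (simp add: linear_sum[OF has_derivative_linear[OF assms]]
        linear_scale[OF has_derivative_linear[OF assms]])
  finally show ?thesis
    by (simp add: grad_def inner_vec_def frechet_derivative_at[OF assms, symmetric])
qed

text \<open>The integrand is the derivative of \<open>f \<bullet> g\<close> in the direction
  \<open>u\<close>, so this is membership in \<open>L2_div\<close> tested with the potential
  \<open>f \<bullet> g\<close>.\<close>

lemma L2_div_inner_derivative:
  fixes f g :: "real^'n \<Rightarrow> real^'n"
  assumes u: "u \<in> L2_div" and smooth: "smooth_on UNIV f" "smooth_on UNIV g"
    and per: "periodic f" "periodic g"
    and der: "\<And>x. (f has_derivative f' x) (at x)" "\<And>x. (g has_derivative g' x) (at x)"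
  shows "(LINT x|torus. f x \<bullet> g' x (u x) + f' x (u x) \<bullet> g x) = 0"
proof -
  have "smooth_on UNIV (\<lambda>x. f x \<bullet> g x)"
    using smooth Ck_on_bounded_bilinear[OF bounded_bilinear_inner] unfolding smooth_on_def by blast
  moreover have "periodic (\<lambda>x. f x \<bullet> g x)"
    using per by (simp add: periodic_def)
  ultimately have "L2_inner u (grad (\<lambda>x. f x \<bullet> g x)) = 0"
    using u by (simp add: L2_div_def)
  then show ?thesis
    by (simp add: L2_inner_def inner_grad[OF has_derivative_inner[OF der]])
qed

text \<open>In general the divergence of \<open>f \<otimes> f\<close> is
  \<open>(f \<bullet> \<nabla>) f\<close> plus \<open>f\<close> times its divergence. The lemma
  turns the projection relation for \<open>\<omega>\<close> into one about the directional
  derivative of \<open>\<beta>\<close> along itself.\<close>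

lemma matrix_divergence_outer:
  fixes f :: "real^'n \<Rightarrow> real^'n"
  assumes der: "(f has_derivative f') (at x)" and div: "divergence f x = 0"
  shows "matrix_divergence (\<lambda>x. outer (f x) (f x)) x = f' (f x)"
proof -
  have "divergence (\<lambda>y. outer (f y) (f y) $ i) x = f' (f x) $ i" for i
  proof -
    have "((\<lambda>y. f y $ i *\<^sub>R f y) has_derivative (\<lambda>h. f x $ i *\<^sub>R f' h + f' h $ i *\<^sub>R f x)) (at x)"
      by (rule has_derivative_scaleR[OF bounded_linear.has_derivative[OF bounded_linear_vec_nth der] der])
    moreover have "(\<lambda>y. outer (f y) (f y) $ i) = (\<lambda>y. f y $ i *\<^sub>R f y)"
      by (simp add: fun_eq_iff outer_def vec_eq_iff)
    ultimately have "divergence (\<lambda>y. outer (f y) (f y) $ i) x =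
        (\<Sum>j\<in>UNIV. (f x $ i *\<^sub>R f' (axis j 1) + f' (axis j 1) $ i *\<^sub>R f x) $ j)"
      by (simp only: divergence_eq_sum)
    also have "\<dots> = f x $ i * (\<Sum>j\<in>UNIV. f' (axis j 1) $ j) + (\<Sum>j\<in>UNIV. f x $ j * f' (axis j 1) $ i)"
      by (simp add: sum.distrib sum_distrib_left mult.commute)
    also have "(\<Sum>j\<in>UNIV. f' (axis j 1) $ j) = 0"
      using div divergence_eq_sum[OF der] by simp
    also have "(\<Sum>j\<in>UNIV. f x $ j * f' (axis j 1) $ i) = f' (\<Sum>j\<in>UNIV. f x $ j *\<^sub>R axis j 1) $ i"
      by (simp add: linear_sum[OF has_derivative_linear[OF der]]
          linear_scale[OF has_derivative_linear[OF der]])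
    also have "(\<Sum>j\<in>UNIV. f x $ j *\<^sub>R axis j 1) = f x"
      using basis_expansion[of "f x"] by (simp add: scalar_mult_eq_scaleR)
    finally show ?thesis by simp
  qed
  then show ?thesis by (simp add: matrix_divergence_def vec_eq_iff)
qed

section \<open>The two solutions: regularity and uniform bounds\<close>

locale weak_strong =
  fixes T :: real and B0 :: "real^'n \<Rightarrow> (real, 'n::finite) vec"
    and B v \<beta> \<omega> :: "real \<Rightarrow> real^'n \<Rightarrow> (real, 'n::finite) vec"
  assumes T: "0 < T" and weak: "dissipative_solution T B0 B v" and strong: "smooth_solution T \<beta> \<omega>"
begin

abbreviation I :: "real set" where "I \<equiv> {0..T}"
abbreviation A :: "real \<Rightarrow> real^'n \<Rightarrow> real^'n^'n" where "A t x \<equiv> jacobian (\<beta> t) (at x)"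
abbreviation M :: "real \<Rightarrow> real^'n \<Rightarrow> real^'n^'n" where "M t x \<equiv> jacobian (\<omega> t) (at x)"
text \<open>The time derivative of \<open>\<beta>\<close> as prescribed by the strong equation. Only
  spatial derivatives enter, so its continuity on the closed slab is inherited from theirs.\<close>

abbreviation D :: "real \<Rightarrow> real^'n \<Rightarrow> real^'n" where "D t x \<equiv> M t x *v \<beta> t x - A t x *v \<omega> t x"

definition L :: real where "L = spatial_lipschitz_constant T \<beta> \<omega>"
definition r :: real where "r = 2 * L + 8 * L\<^sup>2"

lemma smooth: "smooth_on (I \<times> UNIV) (\<lambda>(t, x). \<beta> t x)" "smooth_on (I \<times> UNIV) (\<lambda>(t, x). \<omega> t x)"
  using strong by (auto simp: smooth_solution_def)

lemma periodic_fields: "t \<in> I \<Longrightarrow> periodic (\<beta> t)" "t \<in> I \<Longrightarrow> periodic (\<omega> t)"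
  using strong by (auto simp: smooth_solution_def)

lemma divergence_free: "t \<in> I \<Longrightarrow> divergence (\<beta> t) x = 0" "t \<in> I \<Longrightarrow> divergence (\<omega> t) x = 0"
  using strong by (auto simp: smooth_solution_def)

lemma velocity_projection: "t \<in> I \<Longrightarrow> helmholtz_projection (matrix_divergence (\<lambda>x. outer (\<beta> t x) (\<beta> t x))) (\<omega> t)"
  using strong by (auto simp: smooth_solution_def)

lemmas der_\<beta> = smooth_slab_derivatives(1)[OF smooth(1)]
lemmas der_\<omega> = smooth_slab_derivatives(1)[OF smooth(2)]

lemma time_derivative:
  assumes t: "t \<in> I"
  shows "((\<lambda>s. \<beta> s x) has_vector_derivative D t x) (at t within I)"
proof -
  have "vector_derivative (\<lambda>s. \<beta> s x) (at t within I) + A t x *v \<omega> t x - M t x *v \<beta> t x = 0"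
    using strong t by (auto simp: smooth_solution_def)
  then have "vector_derivative (\<lambda>s. \<beta> s x) (at t within I) = D t x"
    by (simp add: algebra_simps)
  with smooth_slab_derivatives(2)[OF smooth(1) t, of x] show ?thesis
    using vector_derivative_works by metis
qed

lemma continuous_fields:
  "continuous_on (I \<times> UNIV) (\<lambda>(t, x). \<beta> t x)" "continuous_on (I \<times> UNIV) (\<lambda>(t, x). \<omega> t x)"
  "continuous_on (I \<times> UNIV) (\<lambda>(t, x). A t x)" "continuous_on (I \<times> UNIV) (\<lambda>(t, x). M t x)"
  by (rule Ck_on_continuous[OF smooth(1)[unfolded smooth_on_def, THEN spec, of 0]]
      Ck_on_continuous[OF smooth(2)[unfolded smooth_on_def, THEN spec, of 0]]
      smooth_slab_derivatives(3)[OF smooth(1)] smooth_slab_derivatives(3)[OF smooth(2)])+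

lemma cont_D: "continuous_on (I \<times> UNIV) (\<lambda>(t, x). D t x)"
  using continuous_fields unfolding split_beta'
  by (intro continuous_on_diff continuous_on_matrix_vector_mult)

lemmas continuous_slices = continuous_fields[THEN slab_slice_continuous] cont_D[THEN slab_slice_continuous]

lemma lipschitz: "t \<in> I \<Longrightarrow> L-lipschitz_on UNIV (\<lambda>x. (\<beta> t x, \<omega> t x))"
  unfolding L_def using T periodic_fields
  by (intro spatial_lipschitz_constant_lipschitz smooth) auto

lemma L_nonneg: "0 \<le> L"
  using lipschitz[of 0] T by (auto dest: lipschitz_on_nonneg)

lemma r_nonneg: "0 \<le> r"
  using L_nonneg by (simp add: r_def)

lemma A_bound: "norm (A t x *v h) \<le> L * norm h" and M_bound: "norm (M t x *v h) \<le> L * norm h"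
  if t: "t \<in> I"
proof -
  have "L-lipschitz_on UNIV (\<beta> t)" "L-lipschitz_on UNIV (\<omega> t)"
    using order_trans[OF dist_fst_le lipschitz_onD[OF lipschitz[OF t]]]
      order_trans[OF dist_snd_le lipschitz_onD[OF lipschitz[OF t]]] L_nonneg
    by (auto intro!: lipschitz_onI)
  then show "norm (A t x *v h) \<le> L * norm h" "norm (M t x *v h) \<le> L * norm h"
    using lipschitz_derivative_bound[OF _ der_\<beta>[OF t]] lipschitz_derivative_bound[OF _ der_\<omega>[OF t]]
    by blast+
qed

lemma B_L2_div: "t \<in> I \<Longrightarrow> B t \<in> L2_div"
  using weak by (auto simp: dissipative_solution_def weakly_continuous_L2_div_def)

lemma v_L2_div: "AE t in lborel. t \<in> I \<longrightarrow> v t \<in> L2_div"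
  using weak by (auto simp: dissipative_solution_def square_integrable_L2_div_def)

lemma v_int: "set_integrable lborel I (\<lambda>t. (L2_norm (v t))\<^sup>2)"
  using weak by (auto simp: dissipative_solution_def square_integrable_L2_div_def)

lemma \<omega>_L2_div: "t \<in> I \<Longrightarrow> \<omega> t \<in> L2_div"
  using velocity_projection by (auto simp: helmholtz_projection_def)

text \<open>Weak continuity of \<open>B\<close> is stated only against elements of
  \<open>L2_div\<close>, so \<open>\<beta> t\<close> has to be one of them.\<close>

lemma \<beta>_L2_div:
  assumes t: "t \<in> I"
  shows "\<beta> t \<in> L2_div"
  unfolding L2_div_def L2_def mem_Collect_eq
proof (intro conjI allI impI)
  show "periodic (\<beta> t)" by (rule periodic_fields(1)[OF t])
  show "\<beta> t \<in> borel_measurable borel" by (rule borel_measurable_continuous_onI[OF continuous_slices(1)[OF t]])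
  show "integrable torus (\<lambda>x. (norm (\<beta> t x))\<^sup>2)"
    using sq_int_continuous[OF continuous_slices(1)[OF t]] by (simp add: sq_int_def)
  fix \<phi> :: "real^'n \<Rightarrow> real" assume \<phi>: "periodic \<phi> \<and> smooth_on UNIV \<phi>"
  then have "Ck_on 1 UNIV \<phi>" by (simp add: smooth_on_def)
  then show "L2_inner (\<beta> t) (grad \<phi>) = 0"
    using \<phi> by (intro divergence_free_L2_inner_grad periodic_fields(1)[OF t] divergence_free(1)[OF t]
        smooth_slab_slice[OF smooth(1) t]) auto
qed

lemma sq_int_fields:
  "t \<in> I \<Longrightarrow> sq_int (B t)" "t \<in> I \<Longrightarrow> sq_int (\<beta> t)" "t \<in> I \<Longrightarrow> sq_int (\<omega> t)" "t \<in> I \<Longrightarrow> sq_int (D t)"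
  using B_L2_div sq_int_L2_div sq_int_continuous[OF continuous_slices(1)] sq_int_continuous[OF continuous_slices(2)]
    sq_int_continuous[OF continuous_slices(5)] by blast+

lemma measurable_fields: "slab_meas T B" "slab_meas T v" "slab_meas T \<beta>" "slab_meas T \<omega>" "slab_meas T A" "slab_meas T M"
  "slab_meas T D"
  using weak continuous_fields[THEN slab_meas_continuous] cont_D[THEN slab_meas_continuous]
  by (simp_all add: dissipative_solution_def square_integrable_L2_div_def
      weakly_continuous_L2_div_def spacetime_measurable_def slab_meas_def)

lemmas measurable_intros = measurable_fields slab_meas_add slab_meas_diff slab_meas_const
  slab_meas_bilinear[OF bounded_bilinear_matrix_vector_mult]
  slab_meas_bilinear[OF bounded_bilinear_inner]
  slab_meas_bilinear[OF bounded_bilinear_mult]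

section \<open>The dissipation inequality with constant rate\<close>

lemma dissipation:
  assumes c: "0 \<le> c" and t: "t \<in> I"
  shows "ennreal ((L2_norm (B t))\<^sup>2) +
      (\<integral>\<^sup>+ s\<in>{0..t}. (ennreal ((L2_norm (v s))\<^sup>2) + e2ennreal (K_functional c (B s))) *
         ennreal (exp (c * t - c * s)) \<partial>lborel)
      \<le> ennreal ((L2_norm (B 0))\<^sup>2 * exp (c * t))"
proof -
  define R where "R t = (LINT s:{0..t}|lborel. c)" for t :: real
  \<comment> \<open>For negative \<open>t\<close> the interval is empty and \<open>R t\<close> is 0,
    so the linear formula is claimed only for the nonnegative times over which the integral
    runs.\<close>
  have R: "R t = c * t" if "0 \<le> t" for t
    using that by (simp add: R_def set_lebesgue_integral_def)
  have "set_integrable lborel I (\<lambda>s. c)"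
    by (rule borel_integrable_atLeastAtMost') (rule continuous_on_const)
  then have "(\<forall>s\<in>I. 0 \<le> c) \<and> set_integrable lborel I (\<lambda>s. c) \<and> (\<forall>t. R t = (LINT s:{0..t}|lborel. c))"
    using c R_def by auto
  moreover have "dissipation_inequality T B v"
    using weak by (simp add: dissipative_solution_def)
  ultimately have "ennreal ((L2_norm (B t))\<^sup>2) +
      (\<integral>\<^sup>+ s\<in>{0..t}. (ennreal ((L2_norm (v s))\<^sup>2) + e2ennreal (K_functional c (B s))) *
         ennreal (exp (R t - R s)) \<partial>lborel)
      \<le> ennreal ((L2_norm (B 0))\<^sup>2 * exp (R t))"
    unfolding dissipation_inequality_def using t by (elim allE impE) (assumption, erule bspec)
  moreover have "(\<integral>\<^sup>+ s\<in>{0..t}. (ennreal ((L2_norm (v s))\<^sup>2) + e2ennreal (K_functional c (B s))) *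
         ennreal (exp (R t - R s)) \<partial>lborel) =
      (\<integral>\<^sup>+ s\<in>{0..t}. (ennreal ((L2_norm (v s))\<^sup>2) + e2ennreal (K_functional c (B s))) *
         ennreal (exp (c * t - c * s)) \<partial>lborel)"
    by (rule nn_integral_cong) (use R t in \<open>auto simp: indicator_def\<close>)
  ultimately show ?thesis using R t by simp
qed

text \<open>Rate 0, with the nonnegative integral dropped. This uniform bound enters the
  integrability of \<open>k\<close> and \<open>H\<close> and the continuity of
  \<open>G\<close>.\<close>

lemma energy_bound: "t \<in> I \<Longrightarrow> (L2_norm (B t))\<^sup>2 \<le> (L2_norm (B 0))\<^sup>2"
proof -
  assume t: "t \<in> I"
  have "ennreal ((L2_norm (B t))\<^sup>2) \<le> ennreal ((L2_norm (B 0))\<^sup>2 * exp (0 * t))"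
    using dissipation[OF order_refl t] by (rule order_trans[OF add_increasing2[OF zero_le order_refl]])
  then show ?thesis by simp
qed

text \<open>The functional under the supremum in \<open>K_functional r (B s)\<close>, at
  \<open>z = - \<omega> s\<close>. It may be negative, but it is real and integrable in time, so it
  can stand in for the supremum inside a real integral.\<close>

definition k :: "real \<Rightarrow> real" where
  "k s = (LINT x|torus. - 2 * (B s x \<bullet> (M s x *v B s x)) + r * (B s x \<bullet> B s x)) -
     (LINT x|torus. \<omega> s x \<bullet> \<omega> s x)"

lemma K_functional_lower_bound:
  assumes s: "s \<in> I"
  shows "ereal (k s) \<le> K_functional r (B s)"
proof -
  let ?z = "\<lambda>x. - \<omega> s x"
  have der: "(?z has_derivative (\<lambda>h. (- M s x) *v h)) (at x)" for x
  proof -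
    have "(?z has_derivative (\<lambda>h. - (M s x *v h))) (at x)"
      by (rule has_derivative_minus[OF der_\<omega>[OF s]])
    moreover have "(\<lambda>h. - (M s x *v h)) = (\<lambda>h. (- M s x) *v h)"
      using bounded_bilinear.minus_left[OF bounded_bilinear_matrix_vector_mult] by metis
    ultimately show ?thesis by simp
  qed
  have jac: "jacobian ?z (at x) = - M s x" for x
    using jacobian_has_derivative(1)[OF der] by simp
  have strain: "y \<bullet> (strain r ?z x *v y) = - 2 * (y \<bullet> (M s x *v y)) + r * (y \<bullet> y)" for x y
  proof -
    have "strain r ?z x *v y = (- M s x) *v y + transpose (- M s x) *v y + r *\<^sub>R y"
      unfolding strain_def jac matrix_vector_mult_add_rdistrib scaleR_matrix_vector_assoc[symmetric]
      by simp
    then have "y \<bullet> (strain r ?z x *v y) = 2 * (y \<bullet> ((- M s x) *v y)) + r * (y \<bullet> y)"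
      by (simp only: inner_add_right inner_transpose_self inner_scaleR_right)
    also have "(- M s x) *v y = - (M s x *v y)"
      using bounded_bilinear.minus_left[OF bounded_bilinear_matrix_vector_mult] by metis
    finally show ?thesis by simp
  qed
  have "?z \<in> K_admissible r"
    unfolding K_admissible_def mem_Collect_eq
  proof (intro conjI allI)
    show "periodic ?z" using periodic_fields(2)[OF s] by (simp add: periodic_def)
    show "Ck_on 1 UNIV ?z"
      by (intro Ck_on_bounded_linear[OF bounded_linear_minus[OF bounded_linear_ident]]
          smooth_slab_slice[OF smooth(2) s])
    have "trace (- M s x) = - trace (M s x)" for x
      by (simp add: trace_def sum_negf)
    then show "divergence ?z x = 0" for x
      using divergence_free(2)[OF s, of x] by (simp add: divergence_def jac)
    show "nonneg_matrix (strain r ?z x)" for x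
      unfolding nonneg_matrix_def
    proof
      fix y
      \<comment> \<open>The share \<open>2 * L\<close> of \<open>r\<close> compensates twice the
        bound derived here; the remaining share \<open>8 * L\<^sup>2\<close> has the right
        sign.\<close>
      have "y \<bullet> (M s x *v y) \<le> norm y * norm (M s x *v y)" by (rule norm_cauchy_schwarz)
      also have "\<dots> \<le> norm y * (L * norm y)"
        by (intro mult_left_mono M_bound[OF s]) auto
      also have "\<dots> = L * (y \<bullet> y)" by (simp add: dot_square_norm power2_eq_square)
      finally have "y \<bullet> (M s x *v y) \<le> L * (y \<bullet> y)" .
      moreover have "0 \<le> 8 * L\<^sup>2 * (y \<bullet> y)" by simp
      ultimately show "0 \<le> y \<bullet> (strain r ?z x *v y)"
        unfolding strain unfolding r_def distrib_right by linarith
    qed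
  qed
  then have "ereal ((LINT x|torus. outer (B s x) (B s x) \<bullet> strain r ?z x) - (L2_norm ?z)\<^sup>2) \<le>
      K_functional r (B s)"
    unfolding K_functional_def by (rule SUP_upper)
  then show ?thesis
    by (simp add: k_def outer_inner strain L2_norm_sq)
qed

lemma continuous_integrals:
  "continuous_on I (\<lambda>t. LINT x|torus. \<omega> t x \<bullet> \<omega> t x)" "continuous_on I (\<lambda>t. LINT x|torus. \<beta> t x \<bullet> \<beta> t x)"
  "continuous_on I (\<lambda>t. LINT x|torus. \<beta> t x \<bullet> D t x)" "continuous_on I (\<lambda>t. LINT x|torus. D t x \<bullet> D t x)"
  using continuous_fields cont_D unfolding split_beta'
  by (auto intro!: slab_integral_continuous continuous_on_inner simp: split_beta')

lemma matrix_inner_bound: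
  assumes "\<And>h. norm (N *v h) \<le> L * norm h"
  shows "\<bar>(x :: real^'n) \<bullet> (N *v y)\<bar> \<le> L * (x \<bullet> x + y \<bullet> y) / 2"
proof -
  have "\<bar>x \<bullet> (N *v y)\<bar> \<le> norm x * norm (N *v y)" by (rule Cauchy_Schwarz_ineq2)
  also have "\<dots> \<le> norm x * (L * norm y)" by (intro mult_left_mono assms) auto
  also have "\<dots> = L * (norm x * norm y)" by (simp add: mult_ac)
  also have "\<dots> \<le> L * ((x \<bullet> x + y \<bullet> y) / 2)"
    using sum_squares_bound[of "norm x" "norm y"] L_nonneg
    by (intro mult_left_mono) (auto simp: dot_square_norm power2_eq_square)
  finally show ?thesis by simp
qed

lemma k_integrable: "set_integrable lborel I k"
  unfolding k_def
proof (rule set_integral_diff(1), rule slab_integral_integrable)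
  show "slab_meas T (\<lambda>s x. - 2 * (B s x \<bullet> (M s x *v B s x)) + r * (B s x \<bullet> B s x))"
    by (intro measurable_intros)
  show "set_integrable lborel I (\<lambda>t. (2 * L + r) * (L2_norm (B 0))\<^sup>2)"
    by (rule borel_integrable_atLeastAtMost') (rule continuous_on_const)
  show "set_integrable lborel I (\<lambda>s. LINT x|torus. \<omega> s x \<bullet> \<omega> s x)"
    by (rule borel_integrable_atLeastAtMost'[OF continuous_integrals(1)])
  show "AE s in lborel. s \<in> I \<longrightarrow>
      \<bar>LINT x|torus. - 2 * (B s x \<bullet> (M s x *v B s x)) + r * (B s x \<bullet> B s x)\<bar> \<le> (2 * L + r) * (L2_norm (B 0))\<^sup>2"
  proof (intro AE_I2 impI)
    fix s assume s: "s \<in> I"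
    have "\<bar>LINT x|torus. - 2 * (B s x \<bullet> (M s x *v B s x)) + r * (B s x \<bullet> B s x)\<bar> \<le>
        (LINT x|torus. (2 * L + r) * (B s x \<bullet> B s x))"
      unfolding real_norm_def[symmetric]
    proof (rule Bochner_Integration.integral_norm_bound_integral)
      show "integrable torus (\<lambda>x. - 2 * (B s x \<bullet> (M s x *v B s x)) + r * (B s x \<bullet> B s x))"
        by (intro Bochner_Integration.integrable_add integrable_mult_right sq_int_inner
            sq_int_matrix sq_int_fields s continuous_slices)
      show "integrable torus (\<lambda>x. (2 * L + r) * (B s x \<bullet> B s x))"
        by (intro integrable_mult_right sq_int_inner sq_int_fields s)
      fix x
      have "\<bar>B s x \<bullet> (M s x *v B s x)\<bar> \<le> L * (B s x \<bullet> B s x)"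
        using matrix_inner_bound[OF M_bound[OF s], of "B s x" x "B s x"] by simp
      moreover have "0 \<le> r * (B s x \<bullet> B s x)" using r_nonneg by simp
      ultimately show "norm (- 2 * (B s x \<bullet> (M s x *v B s x)) + r * (B s x \<bullet> B s x)) \<le>
          (2 * L + r) * (B s x \<bullet> B s x)"
        unfolding real_norm_def distrib_right abs_le_iff by linarith
    qed
    also have "\<dots> = (2 * L + r) * (L2_norm (B s))\<^sup>2"
      by (simp add: L2_norm_sq)
    also have "\<dots> \<le> (2 * L + r) * (L2_norm (B 0))\<^sup>2"
      using energy_bound[OF s] L_nonneg r_nonneg by (intro mult_left_mono) auto
    finally show "\<bar>LINT x|torus. - 2 * (B s x \<bullet> (M s x *v B s x)) + r * (B s x \<bullet> B s x)\<bar> \<le>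
        (2 * L + r) * (L2_norm (B 0))\<^sup>2" .
  qed
qed

lemma exp_integrable:
  assumes "set_integrable lborel I f" "t \<in> I"
  shows "set_integrable lborel {0..t} (\<lambda>s. exp (- r * s) * f s)"
proof (rule set_integrable_continuous_mult)
  show "set_integrable lborel {0..t} f"
    by (rule set_integrable_subset[OF assms(1)]) (use assms(2) in auto)
qed (intro continuous_intros)

text \<open>The passage from extended to real integrals. The supremum is replaced by
  \<open>k\<close> while still under \<open>nn_integral\<close>, where monotonicity holds for
  arbitrary integrands.\<close>

lemma exp_dissipation:
  assumes t: "t \<in> I"
  shows "exp (- r * t) * (L2_norm (B t))\<^sup>2 + (LINT s:{0..t}|lborel. exp (- r * s) * ((L2_norm (v s))\<^sup>2 + k s))
    \<le> (L2_norm (B 0))\<^sup>2"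
proof -
  define f where "f s = exp (- r * s) * ((L2_norm (v s))\<^sup>2 + k s)" for s
  have int: "set_integrable lborel {0..t} f"
    unfolding f_def by (intro exp_integrable set_integral_add(1) v_int k_integrable t)
  \<comment> \<open>As \<open>k\<close> may be negative, the real integrand need not have a sign;
    its positive part is what survives the passage to \<open>ennreal\<close>.\<close>
  have int': "integrable lborel (\<lambda>s. max 0 (exp (r * t) * (indicator {0..t} s *\<^sub>R f s)))"
    using int by (intro integrable_max integrable_mult_right) (auto simp: set_integrable_def)
  have "exp (r * t) * (LINT s:{0..t}|lborel. f s) = (LINT s|lborel. exp (r * t) * (indicator {0..t} s *\<^sub>R f s))"
    by (simp add: set_lebesgue_integral_def)
  also have "\<dots> \<le> (LINT s|lborel. max 0 (exp (r * t) * (indicator {0..t} s *\<^sub>R f s)))"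
    using int by (intro integral_mono int' integrable_mult_right) (auto simp: set_integrable_def)
  finally have 1: "exp (r * t) * (LINT s:{0..t}|lborel. f s) \<le>
      (LINT s|lborel. max 0 (exp (r * t) * (indicator {0..t} s *\<^sub>R f s)))" .
  have "ennreal (LINT s|lborel. max 0 (exp (r * t) * (indicator {0..t} s *\<^sub>R f s))) =
      (\<integral>\<^sup>+ s. ennreal (max 0 (exp (r * t) * (indicator {0..t} s *\<^sub>R f s))) \<partial>lborel)"
    by (rule nn_integral_eq_integral[symmetric]) (use int' in auto)
  also have "\<dots> \<le> (\<integral>\<^sup>+ s\<in>{0..t}. (ennreal ((L2_norm (v s))\<^sup>2) + e2ennreal (K_functional r (B s))) *
         ennreal (exp (r * t - r * s)) \<partial>lborel)"
  proof (rule nn_integral_mono)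
    fix s
    show "ennreal (max 0 (exp (r * t) * (indicator {0..t} s *\<^sub>R f s))) \<le>
      (ennreal ((L2_norm (v s))\<^sup>2) + e2ennreal (K_functional r (B s))) *
         ennreal (exp (r * t - r * s)) * indicator {0..t} s"
    proof (cases "s \<in> {0..t}")
      case True
      then have s: "s \<in> I" using t by auto
      have "ennreal (k s) \<le> e2ennreal (K_functional r (B s))"
        using e2ennreal_mono[OF K_functional_lower_bound[OF s]] by (simp add: e2ennreal_ereal)
      then have "ennreal ((L2_norm (v s))\<^sup>2) + ennreal (k s) \<le>
          ennreal ((L2_norm (v s))\<^sup>2) + e2ennreal (K_functional r (B s))"
        by (rule add_left_mono)
      with _ have "ennreal ((L2_norm (v s))\<^sup>2 + k s) \<le>
          ennreal ((L2_norm (v s))\<^sup>2) + e2ennreal (K_functional r (B s))"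
      proof (rule order_trans)
        \<comment> \<open>\<open>ennreal\<close> truncates at 0, which keeps it subadditive even
          when \<open>k s\<close> is negative.\<close>
        show "ennreal ((L2_norm (v s))\<^sup>2 + k s) \<le> ennreal ((L2_norm (v s))\<^sup>2) + ennreal (k s)"
          by (cases "0 \<le> k s") (auto simp: ennreal_plus ennreal_neg intro!: ennreal_leI)
      qed
      then have "ennreal ((L2_norm (v s))\<^sup>2 + k s) * ennreal (exp (r * t - r * s)) \<le>
          (ennreal ((L2_norm (v s))\<^sup>2) + e2ennreal (K_functional r (B s))) * ennreal (exp (r * t - r * s))"
        by (rule mult_right_mono) simp
      moreover have "ennreal (max 0 (exp (r * t) * f s)) = ennreal ((L2_norm (v s))\<^sup>2 + k s) * ennreal (exp (r * t - r * s))"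
      proof -
        have "exp (r * t) * f s = ((L2_norm (v s))\<^sup>2 + k s) * exp (r * t - r * s)"
          by (simp add: f_def exp_diff exp_minus field_simps)
        then show ?thesis by (simp add: ennreal_mult''[symmetric] max_def ennreal_neg)
      qed
      ultimately show ?thesis using True by simp
    qed simp
  qed
  finally have "ennreal ((L2_norm (B t))\<^sup>2) +
      ennreal (LINT s|lborel. max 0 (exp (r * t) * (indicator {0..t} s *\<^sub>R f s))) \<le>
      ennreal ((L2_norm (B 0))\<^sup>2 * exp (r * t))"
    using order_trans[OF add_left_mono dissipation[OF r_nonneg t]] by blast
  then have "(L2_norm (B t))\<^sup>2 + (LINT s|lborel. max 0 (exp (r * t) * (indicator {0..t} s *\<^sub>R f s))) \<le>
      (L2_norm (B 0))\<^sup>2 * exp (r * t)"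
    by (subst (asm) ennreal_plus[symmetric])
      (auto simp del: ennreal_plus simp: Bochner_Integration.integral_nonneg ennreal_le_iff)
  with 1 have "(L2_norm (B t))\<^sup>2 + exp (r * t) * (LINT s:{0..t}|lborel. f s) \<le> (L2_norm (B 0))\<^sup>2 * exp (r * t)"
    by linarith
  from mult_left_mono[OF this, of "exp (- r * t)"]
  have "exp (- r * t) * (L2_norm (B t))\<^sup>2 + (exp (- r * t) * exp (r * t)) * (LINT s:{0..t}|lborel. f s) \<le>
      (L2_norm (B 0))\<^sup>2 * (exp (- r * t) * exp (r * t))"
    by (simp add: algebra_simps)
  moreover have "exp (- r * t) * exp (r * t) = 1" by (simp add: exp_minus)
  ultimately show ?thesis by (simp add: f_def)
qed

section \<open>Evolution of the cross term and of the smooth energy\<close>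

definition G :: "real \<Rightarrow> real" where "G t = (LINT x|torus. B t x \<bullet> \<beta> t x)"
definition S :: "real \<Rightarrow> real" where "S t = (LINT x|torus. \<beta> t x \<bullet> \<beta> t x)"
text \<open>The weak derivative of \<open>G\<close>: the pairing of \<open>B\<close> with the time
  derivative of \<open>\<beta>\<close>, plus the flux \<open>B \<otimes> v - v \<otimes> B\<close>
  contracted with the Jacobian of \<open>\<beta>\<close>.\<close>

definition H :: "real \<Rightarrow> real" where
  "H t = (LINT x|torus. B t x \<bullet> D t x + B t x \<bullet> (A t x *v v t x) - v t x \<bullet> (A t x *v B t x))"
definition E :: "real \<Rightarrow> real" where "E t = (LINT x|torus. \<beta> t x \<bullet> D t x)"

text \<open>Here everything is smooth: \<open>S\<close> has derivative \<open>2 E\<close> by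
  differentiation under the integral, and the fundamental theorem applies to its product with the
  weight.\<close>

lemma S_identity:
  assumes t: "t \<in> I"
  shows "set_integrable lborel I (\<lambda>s. exp (- r * s) * (2 * E s - r * S s))"
    and "exp (- r * t) * S t - S 0 = (LINT s:{0..t}|lborel. exp (- r * s) * (2 * E s - r * S s))"
proof -
  have contf: "continuous_on I (\<lambda>s. exp (- r * s) * (2 * E s - r * S s))"
    unfolding E_def S_def by (intro continuous_intros continuous_integrals)
  then show "set_integrable lborel I (\<lambda>s. exp (- r * s) * (2 * E s - r * S s))"
    by (rule borel_integrable_atLeastAtMost')
  have S_eq: "S s = integral (cbox 0 1) (\<lambda>x. \<beta> s x \<bullet> \<beta> s x)" if "s \<in> I" for s
    unfolding S_def
    by (intro integral_torus_continuous(2) continuous_on_inner continuous_on_subset[OF continuous_slices(1)[OF that]]) auto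
  have E_eq: "2 * E s = integral (cbox 0 1) (\<lambda>x. \<beta> s x \<bullet> D s x + D s x \<bullet> \<beta> s x)" if "s \<in> I" for s
  proof -
    have "integral (cbox 0 1) (\<lambda>x. \<beta> s x \<bullet> D s x + D s x \<bullet> \<beta> s x) = integral (cbox 0 1) (\<lambda>x. 2 * (\<beta> s x \<bullet> D s x))"
      by (simp add: inner_commute)
    also have "\<dots> = 2 * integral (cbox 0 1) (\<lambda>x. \<beta> s x \<bullet> D s x)"
      by (rule integral_mult_right)
    also have "integral (cbox 0 1) (\<lambda>x. \<beta> s x \<bullet> D s x) = E s"
      unfolding E_def
      by (intro integral_torus_continuous(2)[symmetric] continuous_on_inner
          continuous_on_subset[OF continuous_slices(1)[OF that]] continuous_on_subset[OF continuous_slices(5)[OF that]]) auto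
    finally show ?thesis by simp
  qed
  have dS: "(S has_vector_derivative 2 * E s) (at s within I)" if s: "s \<in> I" for s
  proof -
    have "((\<lambda>s. integral (cbox 0 1) (\<lambda>x. \<beta> s x \<bullet> \<beta> s x)) has_vector_derivative
        integral (cbox 0 1) (\<lambda>x. \<beta> s x \<bullet> D s x + D s x \<bullet> \<beta> s x)) (at s within I)"
    proof (rule leibniz_rule_vector_derivative[OF _ _ _ s])
      show "((\<lambda>s. \<beta> s x \<bullet> \<beta> s x) has_vector_derivative (\<beta> u x \<bullet> D u x + D u x \<bullet> \<beta> u x)) (at u within I)"
        if "u \<in> I" for u x
        using bounded_bilinear.has_vector_derivative[OF bounded_bilinear_inner
            time_derivative[OF that] time_derivative[OF that]] .
      show "(\<lambda>x. \<beta> u x \<bullet> \<beta> u x) integrable_on cbox 0 1" if "u \<in> I" for u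
        by (intro integrable_continuous continuous_on_inner continuous_on_subset[OF continuous_slices(1)[OF that]]) auto
      have "continuous_on (I \<times> cbox 0 1) (\<lambda>(t, x). \<beta> t x)" "continuous_on (I \<times> cbox 0 1) (\<lambda>(t, x). D t x)"
        using continuous_fields(1) cont_D by (auto elim: continuous_on_subset)
      then show "continuous_on (I \<times> cbox 0 1) (\<lambda>(u, x). \<beta> u x \<bullet> D u x + D u x \<bullet> \<beta> u x)"
        unfolding split_beta' by (intro continuous_on_add continuous_on_inner)
    qed simp
    then show ?thesis
      unfolding E_eq[OF s]
      by (rule has_vector_derivative_transform[OF s, rotated]) (simp add: S_eq)
  qed
  have "((\<lambda>s. exp (- r * s) * (2 * E s - r * S s)) has_integral exp (- r * t) * S t - exp (- r * 0) * S 0) {0..t}"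
  proof (rule fundamental_theorem_of_calculus)
    fix s assume s: "s \<in> {0..t}"
    then have "s \<in> I" using t by auto
    then have "(S has_vector_derivative 2 * E s) (at s within {0..t})"
      by (rule has_vector_derivative_within_subset[OF dS]) (use t in auto)
    moreover have "((\<lambda>s. exp (- r * s)) has_vector_derivative - r * exp (- r * s)) (at s within {0..t})"
      unfolding has_real_derivative_iff_has_vector_derivative[symmetric]
      by (auto intro!: derivative_eq_intros)
    ultimately show "((\<lambda>s. exp (- r * s) * S s) has_vector_derivative
        exp (- r * s) * (2 * E s - r * S s)) (at s within {0..t})"
      using has_vector_derivative_mult by (fastforce simp: algebra_simps)
  qed (use t in auto)
  moreover have "set_integrable lborel {0..t} (\<lambda>s. exp (- r * s) * (2 * E s - r * S s))"
    by (rule borel_integrable_atLeastAtMost'[OF continuous_on_subset[OF contf]]) (use t in auto)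
  ultimately show "exp (- r * t) * S t - S 0 = (LINT s:{0..t}|lborel. exp (- r * s) * (2 * E s - r * S s))"
    using set_borel_integral_eq_integral(2) by (fastforce simp: integral_unique)
qed

lemma slab_product_integrable:
  assumes s: "s \<in> I" and v: "v s \<in> L2_div"
  shows "integrable torus (\<lambda>x. B s x \<bullet> D s x)" "integrable torus (\<lambda>x. B s x \<bullet> (A s x *v v s x))"
    "integrable torus (\<lambda>x. v s x \<bullet> (A s x *v B s x))"
  by (intro sq_int_inner sq_int_matrix sq_int_fields s continuous_slices sq_int_L2_div[OF v])+

text \<open>Young's inequality bounds the integrand by three squares: that of \<open>B\<close>,
  controlled by \<open>energy_bound\<close>, that of \<open>D\<close>, whose integral is continuous
  in time, and that of \<open>v\<close>, integrable in time by definition.\<close>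

lemma H_integrable: "set_integrable lborel I H"
  unfolding H_def
proof (rule slab_integral_integrable)
  show "slab_meas T (\<lambda>t x. B t x \<bullet> D t x + B t x \<bullet> (A t x *v v t x) - v t x \<bullet> (A t x *v B t x))"
    by (intro measurable_intros)
  let ?g = "\<lambda>t. (1 + L) * (L2_norm (B 0))\<^sup>2 + (LINT x|torus. D t x \<bullet> D t x) + L * (L2_norm (v t))\<^sup>2"
  show "set_integrable lborel I ?g"
    by (intro set_integral_add(1) set_integrable_mult_right v_int
        borel_integrable_atLeastAtMost' continuous_on_const continuous_integrals)
  show "AE t in lborel. t \<in> I \<longrightarrow>
      \<bar>LINT x|torus. B t x \<bullet> D t x + B t x \<bullet> (A t x *v v t x) - v t x \<bullet> (A t x *v B t x)\<bar> \<le> ?g t"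
    using v_L2_div
  proof eventually_elim
    case (elim t)
    show ?case
    proof
      assume t: "t \<in> I"
      then have v: "v t \<in> L2_div" using elim by simp
      note vs = sq_int_L2_div[OF v]
      have "\<bar>LINT x|torus. B t x \<bullet> D t x + B t x \<bullet> (A t x *v v t x) - v t x \<bullet> (A t x *v B t x)\<bar> \<le>
          (LINT x|torus. (1 + L) * (B t x \<bullet> B t x) + D t x \<bullet> D t x + L * (v t x \<bullet> v t x))"
        unfolding real_norm_def[symmetric]
      proof (rule Bochner_Integration.integral_norm_bound_integral)
        show "integrable torus (\<lambda>x. B t x \<bullet> D t x + B t x \<bullet> (A t x *v v t x) - v t x \<bullet> (A t x *v B t x))"
          by (intro Bochner_Integration.integrable_add Bochner_Integration.integrable_diff
              slab_product_integrable t v)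
        show "integrable torus (\<lambda>x. (1 + L) * (B t x \<bullet> B t x) + D t x \<bullet> D t x + L * (v t x \<bullet> v t x))"
          by (intro Bochner_Integration.integrable_add integrable_mult_right sq_int_inner
              sq_int_fields t vs)
        fix x
        have "\<bar>B t x \<bullet> D t x\<bar> \<le> B t x \<bullet> B t x + D t x \<bullet> D t x"
        proof -
          have "\<bar>B t x \<bullet> D t x\<bar> \<le> norm (B t x) * norm (D t x)" by (rule Cauchy_Schwarz_ineq2)
          moreover have "2 * norm (B t x) * norm (D t x) \<le> B t x \<bullet> B t x + D t x \<bullet> D t x"
            using sum_squares_bound[of "norm (B t x)" "norm (D t x)"] by (simp add: power2_norm_eq_inner)
          moreover have "0 \<le> norm (B t x) * norm (D t x)" by simp
          ultimately show ?thesis by linarith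
        qed
        moreover note matrix_inner_bound[OF A_bound[OF t], of "B t x" x "v t x"]
          matrix_inner_bound[OF A_bound[OF t], of "v t x" x "B t x"]
        moreover have "\<bar>a + b - c\<bar> \<le> d + L * (x + y) / 2 + L * (y + x) / 2"
          if "\<bar>a\<bar> \<le> d" "\<bar>b\<bar> \<le> L * (x + y) / 2" "\<bar>c\<bar> \<le> L * (y + x) / 2" for a b c d x y :: real
          using that by linarith
        ultimately have "\<bar>B t x \<bullet> D t x + B t x \<bullet> (A t x *v v t x) - v t x \<bullet> (A t x *v B t x)\<bar> \<le>
            (B t x \<bullet> B t x + D t x \<bullet> D t x) + L * (B t x \<bullet> B t x + v t x \<bullet> v t x) / 2 +
            L * (v t x \<bullet> v t x + B t x \<bullet> B t x) / 2"
          by blast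
        also have "(b + d) + L * (b + y) / 2 + L * (y + b) / 2 = (1 + L) * b + d + L * y" for b d y
          by (simp add: field_simps)
        finally show "norm (B t x \<bullet> D t x + B t x \<bullet> (A t x *v v t x) - v t x \<bullet> (A t x *v B t x)) \<le>
            (1 + L) * (B t x \<bullet> B t x) + D t x \<bullet> D t x + L * (v t x \<bullet> v t x)"
          by simp
      qed
      also have "\<dots> = (1 + L) * (L2_norm (B t))\<^sup>2 + (LINT x|torus. D t x \<bullet> D t x) + L * (L2_norm (v t))\<^sup>2"
      proof -
        have i: "integrable torus (\<lambda>x. (1 + L) * (B t x \<bullet> B t x))" "integrable torus (\<lambda>x. D t x \<bullet> D t x)"
          "integrable torus (\<lambda>x. L * (v t x \<bullet> v t x))"
          by (intro integrable_mult_right sq_int_inner sq_int_fields t vs)+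
        show ?thesis
          unfolding Bochner_Integration.integral_add[OF Bochner_Integration.integrable_add[OF i(1,2)] i(3)]
            Bochner_Integration.integral_add[OF i(1,2)] L2_norm_sq
          by simp
      qed
      also have "\<dots> \<le> ?g t"
        using energy_bound[OF t] L_nonneg by (intro add_right_mono mult_left_mono) auto
      finally show "\<bar>LINT x|torus. B t x \<bullet> D t x + B t x \<bullet> (A t x *v v t x) - v t x \<bullet> (A t x *v B t x)\<bar> \<le> ?g t" .
    qed
  qed
qed

text \<open>Both factors move with time. In
  \<open>(B t, \<beta> t - \<beta> s) + (B t, \<beta> s)\<close> the first term tends to 0 by
  Cauchy-Schwarz, \<open>energy_bound\<close> and strong continuity of \<open>\<beta>\<close>; the
  second converges by weak continuity of \<open>B\<close>.\<close>

lemma G_continuous: "continuous_on I G"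
  unfolding continuous_on_def
proof
  fix s assume s: "s \<in> I"
  define N where "N t = (LINT x|torus. (\<beta> t x - \<beta> s x) \<bullet> (\<beta> t x - \<beta> s x))" for t
  have diff: "sq_int (\<lambda>x. \<beta> t x - \<beta> s x)" if "t \<in> I" for t
    by (intro sq_int_diff sq_int_fields that s)
  have "continuous_on I N"
    unfolding N_def
  proof (rule slab_integral_continuous)
    have "continuous_on (I \<times> UNIV) (\<lambda>p. \<beta> s (snd p))"
      by (rule continuous_on_compose2[OF continuous_slices(1)[OF s]]) (auto intro!: continuous_intros)
    then show "continuous_on (I \<times> UNIV) (\<lambda>(t, x). (\<beta> t x - \<beta> s x) \<bullet> (\<beta> t x - \<beta> s x))"
      using continuous_fields(1) unfolding split_beta' by (intro continuous_on_inner continuous_on_diff)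
  qed
  then have "(N \<longlongrightarrow> N s) (at s within I)" using s by (simp add: continuous_on_def)
  then have "((\<lambda>t. L2_norm (B 0) * sqrt (N t)) \<longlongrightarrow> L2_norm (B 0) * sqrt (N s)) (at s within I)"
    by (intro tendsto_mult tendsto_const tendsto_real_sqrt)
  then have lim: "((\<lambda>t. L2_norm (B 0) * sqrt (N t)) \<longlongrightarrow> 0) (at s within I)"
    by (simp add: N_def)
  have "((\<lambda>t. L2_inner (B t) (\<lambda>x. \<beta> t x - \<beta> s x)) \<longlongrightarrow> 0) (at s within I)"
  proof (rule Lim_null_comparison[OF _ lim])
    show "\<forall>\<^sub>F t in at s within I. norm (L2_inner (B t) (\<lambda>x. \<beta> t x - \<beta> s x)) \<le> L2_norm (B 0) * sqrt (N t)"
      unfolding eventually_at_filter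
    proof (rule always_eventually, intro allI impI)
      fix t assume t: "t \<in> I"
      have "norm (L2_inner (B t) (\<lambda>x. \<beta> t x - \<beta> s x)) \<le> L2_norm (B t) * L2_norm (\<lambda>x. \<beta> t x - \<beta> s x)"
        using L2_inner_Cauchy_Schwarz[OF sq_int_fields(1)[OF t] diff[OF t]] by simp
      also have "L2_norm (\<lambda>x. \<beta> t x - \<beta> s x) = sqrt (N t)"
        by (simp add: N_def L2_norm_def power2_norm_eq_inner)
      also have "L2_norm (B t) * sqrt (N t) \<le> L2_norm (B 0) * sqrt (N t)"
      proof (rule mult_right_mono)
        show "L2_norm (B t) \<le> L2_norm (B 0)"
          by (rule power2_le_imp_le[OF energy_bound[OF t] L2_norm_nonneg])
        show "0 \<le> sqrt (N t)"
          by (simp add: N_def Bochner_Integration.integral_nonneg)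
      qed
      finally show "norm (L2_inner (B t) (\<lambda>x. \<beta> t x - \<beta> s x)) \<le> L2_norm (B 0) * sqrt (N t)" .
    qed
  qed
  moreover have "((\<lambda>t. L2_inner (B t) (\<beta> s)) \<longlongrightarrow> L2_inner (B s) (\<beta> s)) (at s within I)"
    using weak \<beta>_L2_div[OF s] s
    by (simp add: dissipative_solution_def weakly_continuous_L2_div_def continuous_on_def)
  ultimately have "((\<lambda>t. L2_inner (B t) (\<lambda>x. \<beta> t x - \<beta> s x) + L2_inner (B t) (\<beta> s)) \<longlongrightarrow>
      0 + L2_inner (B s) (\<beta> s)) (at s within I)"
    by (rule tendsto_add)
  moreover have "\<forall>\<^sub>F t in at s within I.
      L2_inner (B t) (\<lambda>x. \<beta> t x - \<beta> s x) + L2_inner (B t) (\<beta> s) = G t"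
    unfolding eventually_at_filter
  proof (rule always_eventually, intro allI impI)
    fix t assume t: "t \<in> I"
    show "L2_inner (B t) (\<lambda>x. \<beta> t x - \<beta> s x) + L2_inner (B t) (\<beta> s) = G t"
      unfolding L2_inner_def G_def
      by (subst Bochner_Integration.integral_add[symmetric])
        (auto simp: inner_diff_right intro!: sq_int_inner Bochner_Integration.integrable_diff sq_int_fields t s)
  qed
  ultimately show "(G \<longlongrightarrow> G s) (at s within I)"
    unfolding G_def L2_inner_def by (simp add: tendsto_cong)
qed

text \<open>The test field is \<open>\<kappa> \<beta>\<close>.\<close>

lemma G_weak_derivative:
  assumes ab: "0 < a" "b < T" and Ck: "\<And>k. Ck_on k UNIV \<kappa>"
    and der: "\<And>t. (\<kappa> has_real_derivative \<kappa>' t) (at t)" and cont': "continuous_on UNIV \<kappa>'"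
    and supp: "\<And>t. t \<notin> {a..b} \<Longrightarrow> \<kappa> t = 0"
  shows "(LINT t:I|lborel. \<kappa>' t * G t + \<kappa> t * H t) = 0"
proof -
  define \<phi> where "\<phi> t x = \<kappa> t *\<^sub>R \<beta> t x" for t x
  have contk: "continuous_on UNIV \<kappa>" using Ck[of 0] by simp
  have supp': "\<kappa>' t = 0" if "t \<notin> {a..b}" for t
  proof -
    have "(\<kappa> has_real_derivative 0) (at t)"
      by (rule has_field_derivative_transform_within_open[of "\<lambda>_. 0" _ _ "- {a..b}"])
        (use that supp in \<open>auto simp: open_Compl\<close>)
    then show ?thesis using DERIV_unique[OF der] by blast
  qed
  have "test_field T \<phi>"
    unfolding test_field_def
  proof (intro conjI allI)
    have "Ck_on k UNIV (\<lambda>p. \<kappa> (fst p) *\<^sub>R (case p of (t, x) \<Rightarrow> \<beta> t x))" for k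
      by (rule Ck_on_cutoff[OF ab Ck supp smooth(1)[unfolded smooth_on_def, THEN spec]])
    moreover have "(\<lambda>p. \<kappa> (fst p) *\<^sub>R (case p of (t, x) \<Rightarrow> \<beta> t x)) = (\<lambda>(t, x). \<phi> t x)"
      by (auto simp: \<phi>_def)
    ultimately show "smooth_on UNIV (\<lambda>(t, x). \<phi> t x)" by (simp add: smooth_on_def)
    show "periodic (\<phi> t)" for t
    proof (cases "t \<in> I")
      case True
      then show ?thesis using periodic_fields(1)[OF True] by (simp add: \<phi>_def periodic_def)
    next
      \<comment> \<open>Off \<open>I\<close> nothing is known about \<open>\<beta> t\<close>, but
        the cutoff vanishes there.\<close>
      case False
      then have "\<kappa> t = 0" using ab by (intro supp) auto
      then show ?thesis by (simp add: \<phi>_def periodic_def)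
    qed
    show "\<exists>a b. 0 < a \<and> b < T \<and> (\<forall>t x. t \<notin> {a..b} \<longrightarrow> \<phi> t x = 0)"
      using ab supp by (intro exI[of _ a] exI[of _ b]) (simp add: \<phi>_def)
  qed
  then have eq0: "(LINT t:I|lborel. LINT x|torus.
      B t x \<bullet> vector_derivative (\<lambda>s. \<phi> s x) (at t) +
        (outer (B t x) (v t x) - outer (v t x) (B t x)) \<bullet> jacobian (\<phi> t) (at x)) = 0"
    using weak by (simp add: dissipative_solution_def weak_induction_def)
  define F where "F t x = \<kappa>' t * (B t x \<bullet> \<beta> t x) +
      \<kappa> t * (B t x \<bullet> D t x + B t x \<bullet> (A t x *v v t x) - v t x \<bullet> (A t x *v B t x))" for t x
  have F: "B t x \<bullet> vector_derivative (\<lambda>s. \<phi> s x) (at t) +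
        (outer (B t x) (v t x) - outer (v t x) (B t x)) \<bullet> jacobian (\<phi> t) (at x) = F t x" if t: "t \<in> I" for t x
  proof -
    have "((\<lambda>s. \<phi> s x) has_vector_derivative (\<kappa> t *\<^sub>R D t x + \<kappa>' t *\<^sub>R \<beta> t x)) (at t)"
    \<comment> \<open>The test field needs two-sided time derivatives, whereas
      \<open>\<beta>\<close> has only one-sided ones at the ends of \<open>I\<close>: on
      \<open>{a..b}\<close> the point is interior to \<open>I\<close>, and elsewhere the field is
      locally zero.\<close>
    proof (cases "t \<in> {a..b}")
      case True
      then have "t \<in> {0<..<T}" using ab by auto
      then have "at t within I = at t" by (intro at_within_interior) simp
      with time_derivative[OF t, of x] have "((\<lambda>s. \<beta> s x) has_vector_derivative D t x) (at t)" by simp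
      then show ?thesis unfolding \<phi>_def by (rule has_vector_derivative_scaleR[OF der])
    next
      case False
      have "((\<lambda>s. \<phi> s x) has_vector_derivative 0) (at t)"
        by (rule has_vector_derivative_transform_within_open[of "\<lambda>_. 0" _ _ "- {a..b}"])
          (use False supp in \<open>auto simp: \<phi>_def open_Compl\<close>)
      then show ?thesis using supp[OF False] supp'[OF False] by simp
    qed
    then have 1: "vector_derivative (\<lambda>s. \<phi> s x) (at t) = \<kappa> t *\<^sub>R D t x + \<kappa>' t *\<^sub>R \<beta> t x"
      by (rule vector_derivative_at)
    have "(\<phi> t has_derivative (\<lambda>h. \<kappa> t *\<^sub>R (A t x *v h))) (at x)"
      unfolding \<phi>_def[abs_def] by (rule has_derivative_scaleR_right[OF der_\<beta>[OF t]])
    then have "(\<phi> t has_derivative (\<lambda>h. (\<kappa> t *\<^sub>R A t x) *v h)) (at x)"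
      by (simp add: scaleR_matrix_vector_assoc)
    from jacobian_has_derivative(1)[OF this] have 2: "jacobian (\<phi> t) (at x) = \<kappa> t *\<^sub>R A t x" by simp
    show ?thesis
      unfolding 1 2 F_def
      by (simp add: inner_diff_left outer_inner inner_add_right inner_diff_right
          scaleR_matrix_vector_assoc[symmetric] algebra_simps)
  qed
  have "(LINT t:I|lborel. LINT x|torus. F t x) = 0"
    by (rule trans[OF set_lebesgue_integral_cong eq0])
      (simp, intro allI impI Bochner_Integration.integral_cong refl F[symmetric])
  moreover have "(LINT t:I|lborel. LINT x|torus. F t x) = (LINT t:I|lborel. \<kappa>' t * G t + \<kappa> t * H t)"
    unfolding set_lebesgue_integral_def
  proof (rule integral_cong_AE)
    have k: "slab_meas T (\<lambda>t x. \<kappa> t)" "slab_meas T (\<lambda>t x. \<kappa>' t)"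
      by (auto intro!: slab_meas_continuous continuous_on_compose2[OF contk]
          continuous_on_compose2[OF cont'] continuous_on_fst simp: split_beta')
    have "slab_meas T F"
      unfolding F_def[abs_def] by (intro measurable_intros k)
    from slab_meas_integral[OF this]
    show "(\<lambda>t. indicator I t *\<^sub>R (LINT x|torus. F t x)) \<in> borel_measurable lborel"
      unfolding set_borel_measurable_def .
    have "set_integrable lborel I (\<lambda>t. \<kappa>' t * G t + \<kappa> t * H t)"
      by (intro set_integral_add(1) borel_integrable_atLeastAtMost' continuous_on_mult G_continuous
          set_integrable_continuous_mult H_integrable continuous_on_subset[OF contk]
          continuous_on_subset[OF cont'] subset_UNIV)
    then show "(\<lambda>t. indicator I t *\<^sub>R (\<kappa>' t * G t + \<kappa> t * H t)) \<in> borel_measurable lborel"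
      unfolding set_integrable_def by (rule borel_measurable_integrable)
    \<comment> \<open>Splitting the inner integral uses that \<open>v t\<close> is
      square-integrable, which is given only for almost every \<open>t\<close>.\<close>
    have "AE t\<in>I in lborel. (LINT x|torus. F t x) = \<kappa>' t * G t + \<kappa> t * H t"
      using v_L2_div
    proof eventually_elim
      case (elim t)
      show ?case
      proof
        assume t: "t \<in> I"
        note int = slab_product_integrable[OF t elim[rule_format, OF t]]
        have "integrable torus (\<lambda>x. B t x \<bullet> \<beta> t x)" by (intro sq_int_inner sq_int_fields t)
        then show "(LINT x|torus. F t x) = \<kappa>' t * G t + \<kappa> t * H t"
          unfolding F_def G_def H_def using int
          by (subst Bochner_Integration.integral_add)
            (simp_all add: Bochner_Integration.integrable_add Bochner_Integration.integrable_diff)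
      qed
    qed
    then show "AE t in lborel. indicator I t *\<^sub>R (LINT x|torus. F t x) = indicator I t *\<^sub>R (\<kappa>' t * G t + \<kappa> t * H t)"
      by eventually_elim (auto simp: indicator_def)
  qed
  ultimately show ?thesis by simp
qed

lemma G_identity:
  assumes "t \<in> I"
  shows "set_integrable lborel I (\<lambda>s. exp (- r * s) * (H s - r * G s))"
    and "exp (- r * t) * G t - G 0 = (LINT s:{0..t}|lborel. exp (- r * s) * (H s - r * G s))"
  by (rule weak_derivative_integral_exp[OF G_continuous H_integrable _ assms];
      rule G_weak_derivative; assumption)+

section \<open>Cancellations and the final estimate\<close>

text \<open>The integrands are \<open>u \<bullet> \<nabla>(\<beta> \<bullet> \<omega>)\<close>, \<open>u \<bullet> \<nabla>\<bar>\<beta>\<bar>\<^sup>2 / 2\<close> and \<open>u \<bullet> (\<nabla> \<bullet> (\<beta> \<otimes> \<beta>) - \<omega>)\<close>.\<close>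

lemma zero_integrals:
  assumes t: "t \<in> I" and u: "u \<in> L2_div"
  shows "(LINT x|torus. \<beta> t x \<bullet> (M t x *v u x) + (A t x *v u x) \<bullet> \<omega> t x) = 0"
    and "(LINT x|torus. \<beta> t x \<bullet> (A t x *v u x)) = 0"
    and "(LINT x|torus. u x \<bullet> (A t x *v \<beta> t x - \<omega> t x)) = 0"
proof -
  have smooth': "smooth_on UNIV (\<beta> t)" "smooth_on UNIV (\<omega> t)"
    using smooth_slab_slice[OF smooth(1) t] smooth_slab_slice[OF smooth(2) t]
    unfolding smooth_on_def by blast+
  show "(LINT x|torus. \<beta> t x \<bullet> (M t x *v u x) + (A t x *v u x) \<bullet> \<omega> t x) = 0"
    by (rule L2_div_inner_derivative[OF u smooth' periodic_fields[OF t] der_\<beta>[OF t] der_\<omega>[OF t]])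
  have "(LINT x|torus. \<beta> t x \<bullet> (A t x *v u x) + (A t x *v u x) \<bullet> \<beta> t x) = 0"
    by (rule L2_div_inner_derivative[OF u smooth'(1) smooth'(1) periodic_fields(1)[OF t] periodic_fields(1)[OF t] der_\<beta>[OF t] der_\<beta>[OF t]])
  moreover have "(LINT x|torus. \<beta> t x \<bullet> (A t x *v u x) + (A t x *v u x) \<bullet> \<beta> t x) =
      2 * (LINT x|torus. \<beta> t x \<bullet> (A t x *v u x))"
    by (simp add: inner_commute)
  ultimately show "(LINT x|torus. \<beta> t x \<bullet> (A t x *v u x)) = 0" by simp
  have "L2_inner (\<lambda>x. matrix_divergence (\<lambda>x. outer (\<beta> t x) (\<beta> t x)) x - \<omega> t x) u = 0"
    using velocity_projection[OF t] u by (simp add: helmholtz_projection_def)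
  then show "(LINT x|torus. u x \<bullet> (A t x *v \<beta> t x - \<omega> t x)) = 0"
    by (simp add: L2_inner_def matrix_divergence_outer[OF der_\<beta>[OF t] divergence_free(1)[OF t]] inner_commute)
qed

text \<open>Up to the weight, the right side is the decay rate of \<open>exp (- r * t)\<close> times
  the relative energy, with contributions from \<open>\<parallel>B\<parallel>\<^sup>2\<close>,
  \<open>- 2 G\<close> and \<open>S\<close> in this order; for the first of them only a lower bound
  of the decay is available.\<close>

lemma relative_dissipation:
  assumes t: "t \<in> I" and vt: "v t \<in> L2_div"
  shows "(L2_norm (\<lambda>x. v t x - \<omega> t x))\<^sup>2 / 2 \<le>
    ((L2_norm (v t))\<^sup>2 + k t) + 2 * (H t - r * G t) - (2 * E t - r * S t)"
proof -
  let ?Q = "\<lambda>x. (let w = v t x - \<omega> t x; b = B t x - \<beta> t x in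
    w \<bullet> w + r * (b \<bullet> b) - 2 * (b \<bullet> (M t x *v b)) - 2 * (w \<bullet> (A t x *v b)) + 2 * (b \<bullet> (A t x *v w)))"
  note i = sq_int_inner sq_int_matrix sq_int_fields sq_int_diff sq_int_L2_div[OF vt] t continuous_slices
    Bochner_Integration.integrable_add Bochner_Integration.integrable_diff integrable_mult_right
  have i1: "integrable torus (\<lambda>x. v t x \<bullet> v t x)" "integrable torus (\<lambda>x. \<omega> t x \<bullet> \<omega> t x)"
    "integrable torus (\<lambda>x. - 2 * (B t x \<bullet> (M t x *v B t x)) + r * (B t x \<bullet> B t x))"
    "integrable torus (\<lambda>x. B t x \<bullet> D t x + B t x \<bullet> (A t x *v v t x) - v t x \<bullet> (A t x *v B t x))"
    "integrable torus (\<lambda>x. \<beta> t x \<bullet> D t x)" "integrable torus (\<lambda>x. B t x \<bullet> \<beta> t x)"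
    "integrable torus (\<lambda>x. \<beta> t x \<bullet> \<beta> t x)"
    by (intro i)+
  have i2: "integrable torus (\<lambda>x. \<beta> t x \<bullet> (M t x *v B t x) + (A t x *v B t x) \<bullet> \<omega> t x)"
    "integrable torus (\<lambda>x. \<beta> t x \<bullet> (A t x *v v t x))" "integrable torus (\<lambda>x. \<beta> t x \<bullet> (A t x *v \<omega> t x))"
    "integrable torus (\<lambda>x. v t x \<bullet> (A t x *v \<beta> t x - \<omega> t x))"
    "integrable torus (\<lambda>x. \<omega> t x \<bullet> (A t x *v \<beta> t x - \<omega> t x))"
    by (intro i)+
  have i3: "integrable torus ?Q" "integrable torus (\<lambda>x. (v t x - \<omega> t x) \<bullet> (v t x - \<omega> t x))"
    unfolding Let_def by (intro i)+
  have "(LINT x|torus. v t x \<bullet> v t x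
      + ((- 2 * (B t x \<bullet> (M t x *v B t x)) + r * (B t x \<bullet> B t x)) - \<omega> t x \<bullet> \<omega> t x)
      + 2 * (B t x \<bullet> D t x + B t x \<bullet> (A t x *v v t x) - v t x \<bullet> (A t x *v B t x))
      - 2 * (\<beta> t x \<bullet> D t x) - 2 * r * (B t x \<bullet> \<beta> t x) + r * (\<beta> t x \<bullet> \<beta> t x)) =
    ((L2_norm (v t))\<^sup>2 + k t) + 2 * H t - 2 * E t - 2 * r * G t + r * S t"
    unfolding k_def H_def E_def G_def S_def L2_norm_sq using i1
    by (simp only: Bochner_Integration.integral_add Bochner_Integration.integral_diff
        Bochner_Integration.integrable_add Bochner_Integration.integrable_diff integrable_mult_right
        integral_mult_right_zero)
  \<comment> \<open>Writing \<open>w\<close> as \<open>v - \<omega>\<close> puts every term beyond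
    \<open>?Q\<close> into the form of \<open>zero_integrals\<close>, with \<open>u\<close> one of
    \<open>v t\<close>, \<open>B t\<close> and \<open>\<omega> t\<close>.\<close>
  moreover have "(LINT x|torus. v t x \<bullet> v t x
      + ((- 2 * (B t x \<bullet> (M t x *v B t x)) + r * (B t x \<bullet> B t x)) - \<omega> t x \<bullet> \<omega> t x)
      + 2 * (B t x \<bullet> D t x + B t x \<bullet> (A t x *v v t x) - v t x \<bullet> (A t x *v B t x))
      - 2 * (\<beta> t x \<bullet> D t x) - 2 * r * (B t x \<bullet> \<beta> t x) + r * (\<beta> t x \<bullet> \<beta> t x)) =
    (LINT x|torus. ?Q x - 2 * (\<beta> t x \<bullet> (M t x *v B t x) + (A t x *v B t x) \<bullet> \<omega> t x)
      + 2 * (\<beta> t x \<bullet> (A t x *v v t x)) - 2 * (\<beta> t x \<bullet> (A t x *v \<omega> t x))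
      - 2 * (v t x \<bullet> (A t x *v \<beta> t x - \<omega> t x)) + 2 * (\<omega> t x \<bullet> (A t x *v \<beta> t x - \<omega> t x))
      + 2 * (\<beta> t x \<bullet> (A t x *v \<omega> t x)))"
    by (intro Bochner_Integration.integral_cong refl, subst relative_energy_identity)
      (simp add: Let_def inner_diff_left matrix_vector_mult_diff_distrib inner_diff_right
        inner_commute[of "A t x *v B t x" "\<omega> t x" for x] algebra_simps)
  moreover have "\<dots> = (LINT x|torus. ?Q x)"
    using i2 i3(1)
    by (simp only: Bochner_Integration.integral_add Bochner_Integration.integral_diff
        Bochner_Integration.integrable_add Bochner_Integration.integrable_diff integrable_mult_right
        integral_mult_right_zero zero_integrals[OF t vt] zero_integrals[OF t B_L2_div[OF t]]
        zero_integrals[OF t \<omega>_L2_div[OF t]])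
  moreover have "(LINT x|torus. (v t x - \<omega> t x) \<bullet> (v t x - \<omega> t x) / 2) \<le> (LINT x|torus. ?Q x)"
  proof (rule integral_mono[OF _ i3(1)])
    show "integrable torus (\<lambda>x. (v t x - \<omega> t x) \<bullet> (v t x - \<omega> t x) / 2)"
      using i3(2) by simp
    show "(v t x - \<omega> t x) \<bullet> (v t x - \<omega> t x) / 2 \<le> ?Q x" for x
      unfolding Let_def r_def
      by (rule relative_energy_lower_bound[OF L_nonneg A_bound[OF t] M_bound[OF t]])
  qed
  moreover have "(LINT x|torus. (v t x - \<omega> t x) \<bullet> (v t x - \<omega> t x) / 2) = (L2_norm (\<lambda>x. v t x - \<omega> t x))\<^sup>2 / 2"
    by (simp add: L2_norm_sq)
  ultimately show ?thesis by (simp add: algebra_simps)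
qed

lemma L2_norm_difference:
  assumes t: "t \<in> I"
  shows "(L2_norm (\<lambda>x. B t x - \<beta> t x))\<^sup>2 = (L2_norm (B t))\<^sup>2 - 2 * G t + S t"
proof -
  have i: "integrable torus (\<lambda>x. B t x \<bullet> B t x)" "integrable torus (\<lambda>x. B t x \<bullet> \<beta> t x)"
    "integrable torus (\<lambda>x. \<beta> t x \<bullet> \<beta> t x)"
    by (intro sq_int_inner sq_int_fields t)+
  have "(L2_norm (\<lambda>x. B t x - \<beta> t x))\<^sup>2 = (LINT x|torus. B t x \<bullet> B t x - 2 * (B t x \<bullet> \<beta> t x) + \<beta> t x \<bullet> \<beta> t x)"
    unfolding L2_norm_sq
    by (simp add: inner_diff_left inner_diff_right inner_commute[of "\<beta> t x" "B t x" for x] algebra_simps)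
  then show ?thesis using i by (simp add: L2_norm_sq G_def S_def)
qed

lemma stability:
  assumes t: "t \<in> I"
  shows "ennreal ((L2_norm (\<lambda>x. B t x - \<beta> t x))\<^sup>2) +
      (\<integral>\<^sup>+ s\<in>{0..t}. ennreal (exp (r * (t - s)) * (1/2) * (L2_norm (\<lambda>x. v s x - \<omega> s x))\<^sup>2) \<partial>lborel)
    \<le> ennreal ((L2_norm (\<lambda>x. B 0 x - \<beta> 0 x))\<^sup>2 * exp (r * t))"
proof -
  have sub: "{0..t} \<subseteq> I" using t by auto
  define W where "W s = (L2_norm (\<lambda>x. v s x - \<omega> s x))\<^sup>2 / 2" for s
  define p1 where "p1 s = exp (- r * s) * ((L2_norm (v s))\<^sup>2 + k s)" for s
  define p2 where "p2 s = exp (- r * s) * (H s - r * G s)" for s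
  define p3 where "p3 s = exp (- r * s) * (2 * E s - r * S s)" for s
  have int: "set_integrable lborel {0..t} p1" "set_integrable lborel {0..t} p2" "set_integrable lborel {0..t} p3"
    using set_integrable_subset[OF G_identity(1)[OF t] _ sub] set_integrable_subset[OF S_identity(1)[OF t] _ sub]
      exp_integrable[OF set_integral_add(1)[OF v_int k_integrable] t]
    by (simp_all add: p1_def[abs_def] p2_def[abs_def] p3_def[abs_def])
  have intp: "set_integrable lborel {0..t} (\<lambda>s. p1 s + 2 * p2 s - p3 s)"
    by (intro set_integral_add(1) set_integral_diff(1) set_integrable_mult_right int)
  have le: "AE s in lborel. s \<in> {0..t} \<longrightarrow> exp (- r * s) * W s \<le> p1 s + 2 * p2 s - p3 s"
    using v_L2_div
  proof eventually_elim
    case (elim s)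
    show ?case
    proof
      assume "s \<in> {0..t}"
      then have s: "s \<in> I" using sub by auto
      have "exp (- r * s) * W s \<le> exp (- r * s) *
          (((L2_norm (v s))\<^sup>2 + k s) + 2 * (H s - r * G s) - (2 * E s - r * S s))"
        unfolding W_def using relative_dissipation[OF s] elim s by (intro mult_left_mono) auto
      then show "exp (- r * s) * W s \<le> p1 s + 2 * p2 s - p3 s"
        by (simp add: p1_def p2_def p3_def algebra_simps)
    qed
  qed
  \<comment> \<open>Nonnegativity of \<open>W\<close> turns the one-sided estimate \<open>le\<close>
    into domination, which yields integrability.\<close>
  have intW: "set_integrable lborel {0..t} (\<lambda>s. exp (- r * s) * W s)"
  proof (rule set_integrable_bound[OF intp])
    have "slab_meas T (\<lambda>s x. exp (- r * s) * ((v s x - \<omega> s x) \<bullet> (v s x - \<omega> s x)) * (1 / 2))"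
      by (intro measurable_intros slab_meas_continuous) (auto intro!: continuous_intros simp: split_beta')
    from slab_meas_integral[OF this]
    have "set_borel_measurable lborel I (\<lambda>s. exp (- r * s) * W s)"
      by (simp add: W_def L2_norm_sq)
    then show "set_borel_measurable lborel {0..t} (\<lambda>s. exp (- r * s) * W s)"
      by (rule set_borel_measurable_subset[OF _ _ sub]) simp
    show "AE s in lborel. s \<in> {0..t} \<longrightarrow> norm (exp (- r * s) * W s) \<le> norm (p1 s + 2 * p2 s - p3 s)"
      using le
    proof eventually_elim
      case (elim s)
      have "0 \<le> exp (- r * s) * W s" by (simp add: W_def)
      then show ?case using elim by auto
    qed
  qed
  have "(LINT s:{0..t}|lborel. exp (- r * s) * W s) \<le> (LINT s:{0..t}|lborel. p1 s + 2 * p2 s - p3 s)"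
    unfolding set_lebesgue_integral_def
  proof (rule integral_mono_AE)
    show "AE s in lborel. indicator {0..t} s *\<^sub>R (exp (- r * s) * W s) \<le> indicator {0..t} s *\<^sub>R (p1 s + 2 * p2 s - p3 s)"
      using le by eventually_elim (auto simp: indicator_def)
  qed (use intW intp in \<open>simp_all only: set_integrable_def\<close>)
  also have "\<dots> = (LINT s:{0..t}|lborel. p1 s) + 2 * (LINT s:{0..t}|lborel. p2 s) - (LINT s:{0..t}|lborel. p3 s)"
    using int by (simp add: set_integral_add set_integral_diff)
  \<comment> \<open>The \<open>p1\<close> integral has a plus sign and is bounded above by the
    dissipation inequality; the other two are exact, so they may enter with either sign.\<close>
  also have "\<dots> \<le> ((L2_norm (B 0))\<^sup>2 - exp (- r * t) * (L2_norm (B t))\<^sup>2) +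
      2 * (exp (- r * t) * G t - G 0) - (exp (- r * t) * S t - S 0)"
    using exp_dissipation[OF t] G_identity(2)[OF t] S_identity(2)[OF t]
    by (simp add: p1_def p2_def p3_def)
  also have "\<dots> = (L2_norm (\<lambda>x. B 0 x - \<beta> 0 x))\<^sup>2 - exp (- r * t) * (L2_norm (\<lambda>x. B t x - \<beta> t x))\<^sup>2"
  proof -
    have "0 \<in> I" using T by simp
    then show ?thesis
      unfolding L2_norm_difference[OF t] L2_norm_difference[OF \<open>0 \<in> I\<close>] by (simp add: algebra_simps)
  qed
  finally have "exp (r * t) * (LINT s:{0..t}|lborel. exp (- r * s) * W s) \<le>
      exp (r * t) * ((L2_norm (\<lambda>x. B 0 x - \<beta> 0 x))\<^sup>2 - exp (- r * t) * (L2_norm (\<lambda>x. B t x - \<beta> t x))\<^sup>2)"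
    by (rule mult_left_mono) simp
  also have "\<dots> = (L2_norm (\<lambda>x. B 0 x - \<beta> 0 x))\<^sup>2 * exp (r * t) -
      (exp (r * t) * exp (- r * t)) * (L2_norm (\<lambda>x. B t x - \<beta> t x))\<^sup>2"
    by (simp only: algebra_simps)
  also have "exp (r * t) * exp (- r * t) = 1" by (simp add: exp_minus)
  finally have main: "(L2_norm (\<lambda>x. B t x - \<beta> t x))\<^sup>2 + exp (r * t) * (LINT s:{0..t}|lborel. exp (- r * s) * W s) \<le>
      (L2_norm (\<lambda>x. B 0 x - \<beta> 0 x))\<^sup>2 * exp (r * t)"
    by simp
  have eq: "exp (r * (t - s)) * (1/2) * (L2_norm (\<lambda>x. v s x - \<omega> s x))\<^sup>2 = exp (r * t) * (exp (- r * s) * W s)" for s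
    by (simp add: W_def right_diff_distrib exp_diff exp_minus field_simps)
  have "(\<integral>\<^sup>+ s\<in>{0..t}. ennreal (exp (r * (t - s)) * (1/2) * (L2_norm (\<lambda>x. v s x - \<omega> s x))\<^sup>2) \<partial>lborel) =
      (\<integral>\<^sup>+ s. ennreal (exp (r * t) * (indicator {0..t} s *\<^sub>R (exp (- r * s) * W s))) \<partial>lborel)"
    unfolding eq by (rule nn_integral_cong) (auto simp: indicator_def)
  also have "\<dots> = ennreal (LINT s|lborel. exp (r * t) * (indicator {0..t} s *\<^sub>R (exp (- r * s) * W s)))"
  proof (rule nn_integral_eq_integral)
    show "integrable lborel (\<lambda>s. exp (r * t) * (indicator {0..t} s *\<^sub>R (exp (- r * s) * W s)))"
      using intW unfolding set_integrable_def by (rule integrable_mult_right)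
  qed (simp add: W_def)
  also have "(LINT s|lborel. exp (r * t) * (indicator {0..t} s *\<^sub>R (exp (- r * s) * W s))) =
      exp (r * t) * (LINT s:{0..t}|lborel. exp (- r * s) * W s)"
    unfolding set_lebesgue_integral_def by (rule integral_mult_right_zero)
  finally have "ennreal ((L2_norm (\<lambda>x. B t x - \<beta> t x))\<^sup>2) +
      (\<integral>\<^sup>+ s\<in>{0..t}. ennreal (exp (r * (t - s)) * (1/2) * (L2_norm (\<lambda>x. v s x - \<omega> s x))\<^sup>2) \<partial>lborel) =
      ennreal ((L2_norm (\<lambda>x. B t x - \<beta> t x))\<^sup>2 + exp (r * t) * (LINT s:{0..t}|lborel. exp (- r * s) * W s))"
    by (subst ennreal_plus)
      (auto simp: set_lebesgue_integral_def W_def intro!: Bochner_Integration.integral_nonneg)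
  then show ?thesis using main by (simp add: ennreal_leI)
qed

end

theorem theorem3p1:
  shows "\<exists>C :: real \<Rightarrow> real.
    \<forall>T B0 B v \<beta> (\<omega> :: real \<Rightarrow> real^'n \<Rightarrow> (real, 'n::finite) vec).
      0 < T \<longrightarrow> dissipative_solution T B0 B v \<longrightarrow> smooth_solution T \<beta> \<omega> \<longrightarrow>
      (let c = C (spatial_lipschitz_constant T \<beta> \<omega>) in
        \<forall>t\<in>{0..T}.
          ennreal ((L2_norm (\<lambda>x. B t x - \<beta> t x))\<^sup>2) +
          (\<integral>\<^sup>+ s\<in>{0..t}. ennreal (exp (c * (t - s)) * (1/2) *
                                 (L2_norm (\<lambda>x. v s x - \<omega> s x))\<^sup>2) \<partial>lborel)
          \<le> ennreal ((L2_norm (\<lambda>x. B 0 x - \<beta> 0 x))\<^sup>2 * exp (c * t)))"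
proof (intro exI[of _ "\<lambda>L. 2 * L + 8 * L\<^sup>2"] allI impI)
  fix T :: real and B0 :: "real^'n \<Rightarrow> real^'n" and B v \<beta> \<omega> :: "real \<Rightarrow> real^'n \<Rightarrow> real^'n"
  assume "0 < T" "dissipative_solution T B0 B v" "smooth_solution T \<beta> \<omega>"
  then interpret weak_strong T B0 B v \<beta> \<omega>
    by unfold_locales
  show "let c = 2 * spatial_lipschitz_constant T \<beta> \<omega> + 8 * (spatial_lipschitz_constant T \<beta> \<omega>)\<^sup>2 in
        \<forall>t\<in>{0..T}.
          ennreal ((L2_norm (\<lambda>x. B t x - \<beta> t x))\<^sup>2) +
          (\<integral>\<^sup>+ s\<in>{0..t}. ennreal (exp (c * (t - s)) * (1/2) *
                                 (L2_norm (\<lambda>x. v s x - \<omega> s x))\<^sup>2) \<partial>lborel)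
          \<le> ennreal ((L2_norm (\<lambda>x. B 0 x - \<beta> 0 x))\<^sup>2 * exp (c * t))"
    using stability unfolding Let_def r_def L_def by blast
qed

end
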